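(* Let $\mathfrak g=\mathfrak s\oplus\mathfrak z\oplus\bigoplus_{\ell=1}^mP_\ell$ be a nondegenerate flat metric Lie algebra and let $r\in\wedge^2\mathfrak g$. Then the Schouten square $[r,r]$ lies in $(\wedge^3\mathfrak g)^{\mathfrak g}$ if and only if $$[r,r]\in\Big(\bigoplus_{\ell=1}^m\mathfrak s_\ell\wedge\mathbb R\omega_\ell\Big)\oplus\Big(\bigoplus_{\ell=1}^m\mathfrak z\wedge\mathbb R\omega_\ell\Big),$$ where $\mathfrak s_\ell=\bigcap_{\ell'\neq\ell}\ker(\lambda_{\ell'})\subset\mathfrak s$. Equivalently, in an adapted basis with $\dim\mathfrak s=k_0$ and weights spanning $\mathfrak s^*$, the $\mathfrak s$-part of $[r,r]$ can occur only along those $\ell$ for which $\mathfrak s_\ell\neq0$.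
   Context: All Lie algebras are finite-dimensional and real. A flat metric Lie algebra is a Lie algebra $\mathfrak g$ with an inner product $\langle\cdot,\cdot\rangle$ such that the left-invariant Riemannian metric it induces on the simply connected Lie group of $\mathfrak g$ has zero curvature. By Milnor's theorem there is an orthogonal decomposition $\mathfrak g=\mathfrak s\oplus\mathfrak z\oplus\mathfrak u$, where $\mathfrak s$ is an abelian subalgebra, $\mathfrak z$ is the center of $\mathfrak g$, $\mathfrak u=[\mathfrak g,\mathfrak g]$ is an even-dimensional abelian ideal, and the operators $\mathrm{ad}_s|_{\mathfrak u}$ ($s\in\mathfrak s$) are skew-symmetric and commute pairwise. Moreover $\mathfrak u=\bigoplus_{\ell=1}^m P_\ell$ orthogonally, where the $P_\ell$ are $2$-dimensional and $\mathfrak s$-invariant, and there are nonzero weights $\lambda_\ell\in\mathfrak s^*\setminus\{0\}$ and orthogonal complex structures $J_\ell\in \mathrm{SO}(P_\ell)$ with $[s,v]=\lambda_\ell(s)J_\ell v$ for $s\in\mathfrak s$, $v\in P_\ell$. Let $(e_\ell,f_\ell)$ be an oriented orthonormal basis of $P_\ell$ with $J_\ell e_\ell=f_\ell$, and $\omega_\ell:=e_\ell\wedge f_\ell\in\wedge^2P_\ell$. An adapted basis means a basis of $\mathfrak g$ compatible with the decomposition $\mathfrak g=\mathfrak s\oplus\mathfrak z\oplus\bigoplus_\ell P_\ell$ (bases of $\mathfrak s$ and of $\mathfrak z$ together with the pairs $(e_\ell,f_\ell)$); $k_0$ denotes $\dim\mathfrak s$, and the weights $\lambda_\ell$ are taken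 to span $\mathfrak s^*$. The $\mathfrak s$-part of $[r,r]$ is its part in $\bigoplus_\ell\mathfrak s\wedge\mathbb R\omega_\ell$, and it occurs along $\ell$ if its component in $\mathfrak s\wedge\mathbb R\omega_\ell$ is nonzero. $\mathfrak g$ is called nondegenerate if: (a) $\lambda_i\neq\pm\lambda_j$ for all $i\neq j$; (b) for any pairwise distinct $i,j,k$ there is no relation $\lambda_k=a\lambda_i+b\lambda_j$ with $a,b\in\{-1,0,1\}$. For $x\in\mathfrak g$, $\mathrm{ad}_x$ is extended to $\wedge^k\mathfrak g$ as a derivation; $(\wedge^3\mathfrak g)^{\mathfrak g}$ is the space of trivectors killed by all $\mathrm{ad}_x$, $x\in\mathfrak g$. The Schouten bracket of bivectors is the bilinear map $\wedge^2\mathfrak g\times\wedge^2\mathfrak g\to\wedge^3\mathfrak g$ with $[a\wedge b,c\wedge d]=[a,c]\wedge b\wedge d-[a,d]\wedge b\wedge c-[b,c]\wedge a\wedge d+[b,d]\wedge a\wedge c$. For subspaces $A,B$ of $\wedge\mathfrak g$, $A\wedge B$ denotes the span of all $a\wedge b$ with $a\in A$, $b\in B$.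
   Formalization: The "Equivalently" clause is false as an equivalence; it is replaced by: [r,r] lies in the sum of the s∧Rω_ℓ and z∧Rω_ℓ with each s-component in s_ℓ∧Rω_ℓ, and occurrence only along ℓ with s_ℓ≠0 is stated as a consequence of invariance. *)

theory Defs
  imports "HOL-Analysis.Analysis"
begin

section \<open>Bivectors and trivectors\<close>

text \<open>
  There is no exterior algebra in the library.  For a finite-dimensional space \<open>V\<close>, the space
  \<open>\<And>\<^sup>k V\<close> is canonically the space of alternating \<open>k\<close>-linear forms on the dual of \<open>V\<close>; the inner
  product is used to identify the dual with \<open>V\<close>.  The universal properties proved below
  (existence: \<open>lift2_wedge2\<close>, \<open>lift3_wedge3\<close>; uniqueness: \<open>linear_eq_on_wedge2\<close>,
  \<open>linear_eq_on_wedge3\<close>) characterise the two spaces independently of this model.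
\<close>

definition alternating2 :: "('a::real_vector \<Rightarrow> 'a \<Rightarrow> 'b::real_vector) \<Rightarrow> bool" where
  "alternating2 h \<longleftrightarrow> bilinear h \<and> (\<forall>a. h a a = 0)"

definition alternating3 :: "('a::real_vector \<Rightarrow> 'a \<Rightarrow> 'a \<Rightarrow> 'b::real_vector) \<Rightarrow> bool" where
  "alternating3 h \<longleftrightarrow>
     (\<forall>b c. linear (\<lambda>a. h a b c)) \<and> (\<forall>a c. linear (\<lambda>b. h a b c)) \<and> (\<forall>a b. linear (\<lambda>c. h a b c)) \<and>
     (\<forall>a b. h a a b = 0 \<and> h a b a = 0 \<and> h b a a = 0)"

typedef (overloaded) 'a bivector = "{t :: 'a::euclidean_space \<Rightarrow> 'a \<Rightarrow> real. alternating2 t}"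
  by (rule exI[of _ "\<lambda>_ _. 0"]) (simp add: alternating2_def bilinear_def linear_iff)

typedef (overloaded) 'a trivector = "{t :: 'a::euclidean_space \<Rightarrow> 'a \<Rightarrow> 'a \<Rightarrow> real. alternating3 t}"
  by (rule exI[of _ "\<lambda>_ _ _. 0"]) (simp add: alternating3_def linear_iff)

setup_lifting type_definition_bivector
setup_lifting type_definition_trivector

instantiation bivector :: (euclidean_space) real_vector
begin
lift_definition zero_bivector :: "'a bivector" is "\<lambda>_ _. 0"
  by (simp add: alternating2_def bilinear_def linear_iff)
lift_definition plus_bivector :: "'a bivector \<Rightarrow> 'a bivector \<Rightarrow> 'a bivector"
  is "\<lambda>s t x y. s x y + t x y"
  by (simp add: alternating2_def bilinear_def linear_iff algebra_simps)
lift_definition minus_bivector :: "'a bivector \<Rightarrow> 'a bivector \<Rightarrow> 'a bivector"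
  is "\<lambda>s t x y. s x y - t x y"
  by (simp add: alternating2_def bilinear_def linear_iff algebra_simps)
lift_definition uminus_bivector :: "'a bivector \<Rightarrow> 'a bivector" is "\<lambda>t x y. - t x y"
  by (simp add: alternating2_def bilinear_def linear_iff algebra_simps)
lift_definition scaleR_bivector :: "real \<Rightarrow> 'a bivector \<Rightarrow> 'a bivector" is "\<lambda>c t x y. c * t x y"
  by (simp add: alternating2_def bilinear_def linear_iff algebra_simps)
instance
  by standard (transfer; simp add: fun_eq_iff algebra_simps)+
end

instantiation trivector :: (euclidean_space) real_vector
begin
lift_definition zero_trivector :: "'a trivector" is "\<lambda>_ _ _. 0"
  by (simp add: alternating3_def linear_iff)
lift_definition plus_trivector :: "'a trivector \<Rightarrow> 'a trivector \<Rightarrow> 'a trivector"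
  is "\<lambda>s t x y z. s x y z + t x y z"
  by (simp add: alternating3_def linear_iff algebra_simps)
lift_definition minus_trivector :: "'a trivector \<Rightarrow> 'a trivector \<Rightarrow> 'a trivector"
  is "\<lambda>s t x y z. s x y z - t x y z"
  by (simp add: alternating3_def linear_iff algebra_simps)
lift_definition uminus_trivector :: "'a trivector \<Rightarrow> 'a trivector" is "\<lambda>t x y z. - t x y z"
  by (simp add: alternating3_def linear_iff algebra_simps)
lift_definition scaleR_trivector :: "real \<Rightarrow> 'a trivector \<Rightarrow> 'a trivector"
  is "\<lambda>c t x y z. c * t x y z"
  by (simp add: alternating3_def linear_iff algebra_simps)
instance
  by standard (transfer; simp add: fun_eq_iff algebra_simps)+
end

definition det2 :: "('a \<Rightarrow> real) \<Rightarrow> ('a \<Rightarrow> real) \<Rightarrow> 'a \<Rightarrow> 'a \<Rightarrow> real" where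
  "det2 p q x y = p x * q y - p y * q x"

definition det3 ::
  "('a \<Rightarrow> real) \<Rightarrow> ('a \<Rightarrow> real) \<Rightarrow> ('a \<Rightarrow> real) \<Rightarrow> 'a \<Rightarrow> 'a \<Rightarrow> 'a \<Rightarrow> real" where
  "det3 p q r x y z =
     p x * q y * r z - p x * q z * r y + p y * q z * r x
     - p y * q x * r z + p z * q x * r y - p z * q y * r x"

lift_definition wedge2 :: "'a::euclidean_space \<Rightarrow> 'a \<Rightarrow> 'a bivector"
  is "\<lambda>a b. det2 ((\<bullet>) a) ((\<bullet>) b)"
  by (simp add: alternating2_def bilinear_def linear_iff det2_def inner_simps algebra_simps)

lift_definition wedge3 :: "'a::euclidean_space \<Rightarrow> 'a \<Rightarrow> 'a \<Rightarrow> 'a trivector"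
  is "\<lambda>a b c. det3 ((\<bullet>) a) ((\<bullet>) b) ((\<bullet>) c)"
  by (simp add: alternating3_def linear_iff det3_def inner_simps algebra_simps)

text \<open>
  \<open>lift2 h\<close> and \<open>lift3 h\<close> are the linear maps on bivectors and trivectors induced by an alternating
  bilinear resp. trilinear \<open>h\<close>.  The factors \<open>1/2\<close> and \<open>1/6\<close> compensate for summing over all
  ordered tuples of basis vectors.
\<close>

definition lift2 :: "('a::euclidean_space \<Rightarrow> 'a \<Rightarrow> 'b::real_vector) \<Rightarrow> 'a bivector \<Rightarrow> 'b" where
  "lift2 h t = (\<Sum>i\<in>Basis. \<Sum>j\<in>Basis. (Rep_bivector t i j / 2) *\<^sub>R h i j)"

definition lift3 :: "('a::euclidean_space \<Rightarrow> 'a \<Rightarrow> 'a \<Rightarrow> 'b::real_vector) \<Rightarrow> 'a trivector \<Rightarrow> 'b" where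
  "lift3 h t = (\<Sum>i\<in>Basis. \<Sum>j\<in>Basis. \<Sum>k\<in>Basis. (Rep_trivector t i j k / 6) *\<^sub>R h i j k)"

lemma alternating2_wedge2: "alternating2 wedge2"
  unfolding alternating2_def bilinear_def linear_iff
  by (intro conjI allI; transfer;
      simp add: fun_eq_iff det2_def inner_simps algebra_simps)

lemma alternating3_wedge3: "alternating3 wedge3"
  unfolding alternating3_def linear_iff
  by (intro conjI allI; transfer;
      simp add: fun_eq_iff det3_def inner_simps algebra_simps)

lemma linear_lift2: "linear (lift2 h)"
  by (simp add: linear_iff lift2_def plus_bivector.rep_eq scaleR_bivector.rep_eq sum.distrib
      scaleR_add_left scaleR_sum_right add_divide_distrib)

lemma linear_lift3: "linear (lift3 h)"
  by (simp add: linear_iff lift3_def plus_trivector.rep_eq scaleR_trivector.rep_eq sum.distrib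
      scaleR_add_left scaleR_sum_right add_divide_distrib)

lemma linear_expand:
  fixes f :: "'a::euclidean_space \<Rightarrow> 'b::real_vector"
  assumes "linear f"
  shows "f x = (\<Sum>i\<in>Basis. (x \<bullet> i) *\<^sub>R f i)"
proof -
  have "f x = f (\<Sum>i\<in>Basis. (x \<bullet> i) *\<^sub>R i)" by (simp add: euclidean_representation)
  also have "\<dots> = (\<Sum>i\<in>Basis. (x \<bullet> i) *\<^sub>R f i)"
    using assms by (simp add: linear_sum linear_cmul)
  finally show ?thesis .
qed

lemma alternating2_swap: "alternating2 h \<Longrightarrow> h b a = - h a b"
proof -
  assume h: "alternating2 h"
  have "h (a + b) (a + b) = 0" "h a a = 0" "h b b = 0" using h by (auto simp: alternating2_def)
  moreover have "h (a + b) (a + b) = h a a + h a b + (h b a + h b b)"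
  proof -
    have "bilinear h" using h by (simp add: alternating2_def)
    then show ?thesis by (simp add: bilinear_ladd bilinear_radd)
  qed
  ultimately have "h b a + h a b = 0" by (simp add: add.commute)
  then show ?thesis by (rule eq_neg_iff_add_eq_0[THEN iffD2])
qed

lemma alternating2_expand:
  fixes h :: "'a::euclidean_space \<Rightarrow> 'a \<Rightarrow> 'b::real_vector"
  assumes h: "alternating2 h"
  shows "(\<Sum>i\<in>Basis. \<Sum>j\<in>Basis. (det2 ((\<bullet>) a) ((\<bullet>) b) i j / 2) *\<^sub>R h i j) = h a b"
proof -
  have l: "\<And>a. linear (\<lambda>b. h a b)" "\<And>b. linear (\<lambda>a. h a b)"
    using h by (auto simp: alternating2_def bilinear_def)
  have E: "h x y = (\<Sum>i\<in>Basis. \<Sum>j\<in>Basis. ((x \<bullet> i) * (y \<bullet> j)) *\<^sub>R h i j)" for x y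
    by (subst linear_expand[OF l(2)], subst linear_expand[OF l(1)]) (simp add: scaleR_sum_right)
  have "(\<Sum>i\<in>Basis. \<Sum>j\<in>Basis. (det2 ((\<bullet>) a) ((\<bullet>) b) i j / 2) *\<^sub>R h i j)
      = (1/2) *\<^sub>R ((\<Sum>i\<in>Basis. \<Sum>j\<in>Basis. ((a \<bullet> i) * (b \<bullet> j)) *\<^sub>R h i j)
         - (\<Sum>i\<in>Basis. \<Sum>j\<in>Basis. ((a \<bullet> j) * (b \<bullet> i)) *\<^sub>R h i j))"
    by (simp add: det2_def sum_subtractf[symmetric] scaleR_sum_right algebra_simps diff_divide_distrib)
  also have "\<dots> = (1/2) *\<^sub>R (h a b - h b a)"
    by (simp add: E[of a b] E[of b a] mult.commute)
  also have "\<dots> = h a b"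
    by (simp add: alternating2_swap[OF h, of b a] flip: scaleR_2)
  finally show ?thesis .
qed

lemma alternating3_swap:
  assumes h: "alternating3 h"
  shows "h b a c = - h a b c" "h a c b = - h a b c"
proof -
  have *: "alternating2 (\<lambda>a b. h a b c)" "alternating2 (\<lambda>b c. h a b c)"
    using h by (auto simp: alternating3_def alternating2_def bilinear_def)
  show "h b a c = - h a b c" by (rule alternating2_swap[OF *(1)])
  show "h a c b = - h a b c" by (rule alternating2_swap[OF *(2)])
qed

lemma alternating3_expand:
  fixes h :: "'a::euclidean_space \<Rightarrow> 'a \<Rightarrow> 'a \<Rightarrow> 'b::real_vector"
  assumes h: "alternating3 h"
  shows "(\<Sum>i\<in>Basis. \<Sum>j\<in>Basis. \<Sum>k\<in>Basis.
      (det3 ((\<bullet>) a) ((\<bullet>) b) ((\<bullet>) c) i j k / 6) *\<^sub>R h i j k) = h a b c"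
proof -
  have l: "\<And>b c. linear (\<lambda>a. h a b c)" "\<And>a c. linear (\<lambda>b. h a b c)" "\<And>a b. linear (\<lambda>c. h a b c)"
    using h by (auto simp: alternating3_def)
  define S where
    "S x y z = (\<Sum>i\<in>Basis. \<Sum>j\<in>Basis. \<Sum>k\<in>Basis. ((x \<bullet> i) * (y \<bullet> j) * (z \<bullet> k)) *\<^sub>R h i j k)"
    for x y z
  have E: "S x y z = h x y z" for x y z
  proof -
    have "h x y z = (\<Sum>i\<in>Basis. (x \<bullet> i) *\<^sub>R h i y z)" by (rule linear_expand[OF l(1)])
    also have "\<dots> = (\<Sum>i\<in>Basis. (x \<bullet> i) *\<^sub>R (\<Sum>j\<in>Basis. (y \<bullet> j) *\<^sub>R h i j z))"
      by (intro sum.cong refl arg_cong2[where f=scaleR] linear_expand[OF l(2)])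
    also have "\<dots> = (\<Sum>i\<in>Basis. (x \<bullet> i) *\<^sub>R (\<Sum>j\<in>Basis. (y \<bullet> j) *\<^sub>R
        (\<Sum>k\<in>Basis. (z \<bullet> k) *\<^sub>R h i j k)))"
      by (intro sum.cong refl arg_cong2[where f=scaleR] linear_expand[OF l(3)])
    also have "\<dots> = S x y z" by (simp add: S_def scaleR_sum_right mult.assoc)
    finally show ?thesis by simp
  qed
  have "(\<Sum>i\<in>Basis. \<Sum>j\<in>Basis. \<Sum>k\<in>Basis. (det3 ((\<bullet>) a) ((\<bullet>) b) ((\<bullet>) c) i j k / 6) *\<^sub>R h i j k)
     = (1/6) *\<^sub>R (S a b c - S a c b + S c a b - S b a c + S b c a - S c b a)"
    unfolding S_def sum_subtractf[symmetric] sum.distrib[symmetric] scaleR_sum_right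
    by (intro sum.cong refl) (simp add: det3_def add_divide_distrib diff_divide_distrib
        scaleR_add_left scaleR_diff_left scaleR_add_right scaleR_diff_right mult_ac)
  also have "\<dots> = (1/6) *\<^sub>R (6 *\<^sub>R h a b c)"
  proof -
    note sw = alternating3_swap[OF h]
    have "h a c b = - h a b c" "h b a c = - h a b c" "h c a b = h a b c" "h b c a = h a b c"
      "h c b a = - h a b c"
      using sw(2)[of a c b] sw(1)[of b a c] sw(1)[of c a b] sw(2)[of b c a] sw(2)[of c b a]
        sw(1)[of c b a] by auto
    moreover have "6 *\<^sub>R v = v + v + v + v + v + v" for v :: 'b
    proof -
      have "6 *\<^sub>R v = (1 + 1 + 1 + 1 + 1 + 1 :: real) *\<^sub>R v" by simp
      also have "\<dots> = v + v + v + v + v + v" by (simp only: scaleR_add_left scaleR_one)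
      finally show ?thesis .
    qed
    ultimately show ?thesis unfolding E by simp
  qed
  finally show ?thesis by simp
qed

lemma lift2_wedge2:
  assumes "alternating2 h"
  shows "lift2 h (wedge2 a b) = h a b"
  using alternating2_expand[OF assms] by (simp add: lift2_def wedge2.rep_eq)

lemma lift3_wedge3:
  assumes "alternating3 h"
  shows "lift3 h (wedge3 a b c) = h a b c"
  using alternating3_expand[OF assms] by (simp add: lift3_def wedge3.rep_eq)

lemma Rep_bivector_sum: "Rep_bivector (sum g A) x y = (\<Sum>i\<in>A. Rep_bivector (g i) x y)"
  by (induction A rule: infinite_finite_induct) (auto simp: zero_bivector.rep_eq plus_bivector.rep_eq)

lemma Rep_trivector_sum: "Rep_trivector (sum g A) x y z = (\<Sum>i\<in>A. Rep_trivector (g i) x y z)"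
  by (induction A rule: infinite_finite_induct) (auto simp: zero_trivector.rep_eq plus_trivector.rep_eq)

lemma bivector_expand: "t = lift2 wedge2 t"
proof -
  have "Rep_bivector (lift2 wedge2 t) x y = Rep_bivector t x y" for x y
  proof -
    have "Rep_bivector (lift2 wedge2 t) x y
       = (\<Sum>i\<in>Basis. \<Sum>j\<in>Basis. (det2 ((\<bullet>) x) ((\<bullet>) y) i j / 2) *\<^sub>R Rep_bivector t i j)"
      unfolding lift2_def Rep_bivector_sum
      by (intro sum.cong refl)
        (simp add: scaleR_bivector.rep_eq wedge2.rep_eq det2_def inner_commute algebra_simps)
    also have "\<dots> = Rep_bivector t x y"
      by (rule alternating2_expand) (use Rep_bivector in auto)
    finally show ?thesis .
  qed
  then show ?thesis by (metis Rep_bivector_inject ext)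
qed

lemma trivector_expand: "t = lift3 wedge3 t"
proof -
  have "Rep_trivector (lift3 wedge3 t) x y z = Rep_trivector t x y z" for x y z
  proof -
    have "Rep_trivector (lift3 wedge3 t) x y z
       = (\<Sum>i\<in>Basis. \<Sum>j\<in>Basis. \<Sum>k\<in>Basis.
            (det3 ((\<bullet>) x) ((\<bullet>) y) ((\<bullet>) z) i j k / 6) *\<^sub>R Rep_trivector t i j k)"
      unfolding lift3_def Rep_trivector_sum
      by (intro sum.cong refl)
        (simp add: scaleR_trivector.rep_eq wedge3.rep_eq det3_def inner_commute algebra_simps)
    also have "\<dots> = Rep_trivector t x y z"
      by (rule alternating3_expand) (use Rep_trivector in auto)
    finally show ?thesis .
  qed
  then show ?thesis by (metis Rep_trivector_inject ext)
qed

lemma linear_eq_on_wedge2: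
  assumes "linear F" "linear G" "\<And>a b. F (wedge2 a b) = G (wedge2 a b)"
  shows "F = G"
proof
  fix t
  show "F t = G t"
    by (subst (1 2) bivector_expand)
      (simp add: lift2_def linear_sum[OF assms(1)] linear_sum[OF assms(2)]
        linear_cmul[OF assms(1)] linear_cmul[OF assms(2)] assms(3))
qed

lemma linear_eq_on_wedge3:
  assumes "linear F" "linear G" "\<And>a b c. F (wedge3 a b c) = G (wedge3 a b c)"
  shows "F = G"
proof
  fix t
  show "F t = G t"
    by (subst (1 2) trivector_expand)
      (simp add: lift3_def linear_sum[OF assms(1)] linear_sum[OF assms(2)]
        linear_cmul[OF assms(1)] linear_cmul[OF assms(2)] assms(3))
qed

definition omega :: "(nat \<Rightarrow> 'a::euclidean_space) \<Rightarrow> (nat \<Rightarrow> 'a) \<Rightarrow> nat \<Rightarrow> 'a bivector" where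
  "omega e f l = wedge2 (e l) (f l)"

definition wedge12 :: "'a::euclidean_space \<Rightarrow> 'a bivector \<Rightarrow> 'a trivector" where
  "wedge12 a w = lift2 (wedge3 a) w"

lemma wedge12_wedge2: "wedge12 a (wedge2 b c) = wedge3 a b c"
  unfolding wedge12_def
  by (rule lift2_wedge2)
    (use alternating3_wedge3 in \<open>auto simp: alternating3_def alternating2_def bilinear_def\<close>)

definition wedge_space :: "'a::euclidean_space set \<Rightarrow> 'a bivector set \<Rightarrow> 'a trivector set" where
  "wedge_space A B = span {wedge12 a b | a b. a \<in> A \<and> b \<in> B}"


section \<open>Flat metric Lie algebras\<close>

locale lie_algebra =
  fixes br :: "'a::euclidean_space \<Rightarrow> 'a \<Rightarrow> 'a"
  assumes br_bilinear: "bilinear br"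
    and br_self: "br x x = 0"
    and jacobi: "br x (br y z) + br y (br z x) + br z (br x y) = 0"

text \<open>
  The inner product is the one of the type.  On left-invariant vector fields the Levi-Civita
  connection of the left-invariant metric is given by the Koszul formula (\<open>koszul\<close> below), in which
  the derivatives of the constant functions \<open>\<langle>y, z\<rangle>\<close> vanish; the curvature tensor is determined by
  its values on left-invariant fields.
\<close>

definition levi_civita :: "('a::euclidean_space \<Rightarrow> 'a \<Rightarrow> 'a) \<Rightarrow> 'a \<Rightarrow> 'a \<Rightarrow> 'a" where
  "levi_civita br x y =
     (\<Sum>b\<in>Basis. ((br x y \<bullet> b - br y b \<bullet> x + br b x \<bullet> y) / 2) *\<^sub>R b)"

definition curvature :: "('a::euclidean_space \<Rightarrow> 'a \<Rightarrow> 'a) \<Rightarrow> 'a \<Rightarrow> 'a \<Rightarrow> 'a \<Rightarrow> 'a" where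
  "curvature br x y z =
     levi_civita br x (levi_civita br y z) - levi_civita br y (levi_civita br x z)
     - levi_civita br (br x y) z"

lemma (in lie_algebra) koszul:
  "2 * (levi_civita br x y \<bullet> z) = br x y \<bullet> z - br y z \<bullet> x + br z x \<bullet> y"
proof -
  let ?g = "\<lambda>z. (br x y \<bullet> z - br y z \<bullet> x + br z x \<bullet> y) / 2"
  have "linear ?g"
    using br_bilinear
    by (simp add: linear_iff bilinear_ladd bilinear_radd bilinear_lmul bilinear_rmul inner_simps
        field_simps)
  then have "?g z = (\<Sum>b\<in>Basis. (z \<bullet> b) *\<^sub>R ?g b)" by (rule linear_expand)
  also have "\<dots> = levi_civita br x y \<bullet> z"
    by (simp add: levi_civita_def inner_sum_left inner_commute[of z] mult.commute)
  finally show ?thesis by simp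
qed

locale flat_metric_lie_algebra = lie_algebra +
  assumes flat: "curvature br x y z = 0"

definition center :: "('a::real_vector \<Rightarrow> 'a \<Rightarrow> 'a) \<Rightarrow> 'a set" where
  "center br = {z. \<forall>x. br z x = 0}"

definition derived :: "('a::real_vector \<Rightarrow> 'a \<Rightarrow> 'a) \<Rightarrow> 'a set" where
  "derived br = span {br x y | x y. True}"

text \<open>
  The orthogonal decomposition \<open>\<gg> = S \<oplus> center \<oplus> P 1 \<oplus> \<dots> \<oplus> P m\<close>.  An element of the dual
  of \<open>S\<close> is represented by any linear functional on the whole space restricting to it, so
  conditions on the weights \<open>lam l\<close> only involve their values on \<open>S\<close>.  In the same way \<open>J l\<close> only
  matters on \<open>P l\<close>; its determinant there is \<open>1\<close> automatically, since \<open>J l\<close> is a complex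
  structure.
\<close>

locale milnor_decomposition = flat_metric_lie_algebra br
  for br :: "'a::euclidean_space \<Rightarrow> 'a \<Rightarrow> 'a" +
  fixes S :: "'a set" and m :: nat and P :: "nat \<Rightarrow> 'a set"
    and lam :: "nat \<Rightarrow> 'a \<Rightarrow> real" and J :: "nat \<Rightarrow> 'a \<Rightarrow> 'a" and e f :: "nat \<Rightarrow> 'a"
  assumes S_subspace: "subspace S"
    and S_abelian: "x \<in> S \<Longrightarrow> y \<in> S \<Longrightarrow> br x y = 0"
    and derived_abelian: "x \<in> derived br \<Longrightarrow> y \<in> derived br \<Longrightarrow> br x y = 0"
    and derived_even: "even (dim (derived br))"
    and orth_S_center: "x \<in> S \<Longrightarrow> y \<in> center br \<Longrightarrow> x \<bullet> y = 0"
    and orth_S_derived: "x \<in> S \<Longrightarrow> y \<in> derived br \<Longrightarrow> x \<bullet> y = 0"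
    and orth_center_derived: "x \<in> center br \<Longrightarrow> y \<in> derived br \<Longrightarrow> x \<bullet> y = 0"
    and sum_S_center_derived: "S + center br + derived br = UNIV"
    and ad_skew: "s \<in> S \<Longrightarrow> x \<in> derived br \<Longrightarrow> y \<in> derived br \<Longrightarrow> br s x \<bullet> y = - (x \<bullet> br s y)"
    and ad_commute: "s \<in> S \<Longrightarrow> t \<in> S \<Longrightarrow> x \<in> derived br \<Longrightarrow> br s (br t x) = br t (br s x)"
    and P_subspace: "l \<in> {1..m} \<Longrightarrow> subspace (P l)"
    and P_dim: "l \<in> {1..m} \<Longrightarrow> dim (P l) = 2"
    and P_invariant: "l \<in> {1..m} \<Longrightarrow> s \<in> S \<Longrightarrow> v \<in> P l \<Longrightarrow> br s v \<in> P l"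
    and P_orth: "k \<in> {1..m} \<Longrightarrow> l \<in> {1..m} \<Longrightarrow> k \<noteq> l \<Longrightarrow> v \<in> P k \<Longrightarrow> w \<in> P l \<Longrightarrow> v \<bullet> w = 0"
    and sum_P: "(\<Sum>l=1..m. P l) = derived br"
    and lam_linear: "l \<in> {1..m} \<Longrightarrow> linear (lam l)"
    and lam_nonzero: "l \<in> {1..m} \<Longrightarrow> \<exists>s\<in>S. lam l s \<noteq> 0"
    and J_linear: "l \<in> {1..m} \<Longrightarrow> linear (J l)"
    and J_into: "l \<in> {1..m} \<Longrightarrow> v \<in> P l \<Longrightarrow> J l v \<in> P l"
    and J_orthogonal: "l \<in> {1..m} \<Longrightarrow> v \<in> P l \<Longrightarrow> w \<in> P l \<Longrightarrow> J l v \<bullet> J l w = v \<bullet> w"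
    and J_complex: "l \<in> {1..m} \<Longrightarrow> v \<in> P l \<Longrightarrow> J l (J l v) = - v"
    and br_weight: "l \<in> {1..m} \<Longrightarrow> s \<in> S \<Longrightarrow> v \<in> P l \<Longrightarrow> br s v = lam l s *\<^sub>R J l v"
    and e_in: "l \<in> {1..m} \<Longrightarrow> e l \<in> P l"
    and f_in: "l \<in> {1..m} \<Longrightarrow> f l \<in> P l"
    and e_unit: "l \<in> {1..m} \<Longrightarrow> norm (e l) = 1"
    and f_unit: "l \<in> {1..m} \<Longrightarrow> norm (f l) = 1"
    and e_f_orth: "l \<in> {1..m} \<Longrightarrow> e l \<bullet> f l = 0"
    and J_e: "l \<in> {1..m} \<Longrightarrow> J l (e l) = f l"

definition nondegenerate :: "'a set \<Rightarrow> nat \<Rightarrow> (nat \<Rightarrow> 'a \<Rightarrow> real) \<Rightarrow> bool" where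
  "nondegenerate S m lam \<longleftrightarrow>
     (\<forall>i\<in>{1..m}. \<forall>j\<in>{1..m}. i \<noteq> j \<longrightarrow>
        \<not> (\<forall>s\<in>S. lam i s = lam j s) \<and> \<not> (\<forall>s\<in>S. lam i s = - lam j s)) \<and>
     (\<forall>i\<in>{1..m}. \<forall>j\<in>{1..m}. \<forall>k\<in>{1..m}. i \<noteq> j \<and> i \<noteq> k \<and> j \<noteq> k \<longrightarrow>
        \<not> (\<exists>a\<in>{-1, 0, 1}. \<exists>b\<in>{-1, 0, 1}. \<forall>s\<in>S. lam k s = a * lam i s + b * lam j s))"

text \<open>The joint kernel \<open>\<ss>\<^sub>l\<close> of all the other weights (all of \<open>S\<close> if \<open>m = 1\<close>).\<close>

definition s_kernel :: "'a set \<Rightarrow> nat \<Rightarrow> (nat \<Rightarrow> 'a \<Rightarrow> real) \<Rightarrow> nat \<Rightarrow> 'a set" where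
  "s_kernel S m lam l = {s \<in> S. \<forall>k\<in>{1..m}. k \<noteq> l \<longrightarrow> lam k s = 0}"


section \<open>Adjoint action and Schouten bracket\<close>

definition ad3 :: "('a::euclidean_space \<Rightarrow> 'a \<Rightarrow> 'a) \<Rightarrow> 'a \<Rightarrow> 'a trivector \<Rightarrow> 'a trivector" where
  "ad3 br x = lift3 (\<lambda>a b c. wedge3 (br x a) b c + wedge3 a (br x b) c + wedge3 a b (br x c))"

definition invariant_trivectors :: "('a::euclidean_space \<Rightarrow> 'a \<Rightarrow> 'a) \<Rightarrow> 'a trivector set" where
  "invariant_trivectors br = {t. \<forall>x. ad3 br x t = 0}"

definition schouten_decomposable ::
  "('a::euclidean_space \<Rightarrow> 'a \<Rightarrow> 'a) \<Rightarrow> 'a \<Rightarrow> 'a \<Rightarrow> 'a \<Rightarrow> 'a \<Rightarrow> 'a trivector" where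
  "schouten_decomposable br a b c d =
     wedge3 (br a c) b d - wedge3 (br a d) b c - wedge3 (br b c) a d + wedge3 (br b d) a c"

definition schouten ::
  "('a::euclidean_space \<Rightarrow> 'a \<Rightarrow> 'a) \<Rightarrow> 'a bivector \<Rightarrow> 'a bivector \<Rightarrow> 'a trivector" where
  "schouten br r t = lift2 (\<lambda>a b. lift2 (schouten_decomposable br a b) t) r"

lemma wedge3_simps:
  "wedge3 (a + a') b c = wedge3 a b c + wedge3 a' b c"
  "wedge3 a (b + b') c = wedge3 a b c + wedge3 a b' c"
  "wedge3 a b (c + c') = wedge3 a b c + wedge3 a b c'"
  "wedge3 (k *\<^sub>R a) b c = k *\<^sub>R wedge3 a b c"
  "wedge3 a (k *\<^sub>R b) c = k *\<^sub>R wedge3 a b c"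
  "wedge3 a b (k *\<^sub>R c) = k *\<^sub>R wedge3 a b c"
  "wedge3 a a b = 0" "wedge3 a b a = 0" "wedge3 b a a = 0"
  using alternating3_wedge3[where 'a='a] by (auto simp: alternating3_def linear_iff)

lemma wedge3_swap:
  "wedge3 b a c = - wedge3 a b c" "wedge3 a c b = - wedge3 a b c"
  by (rule alternating3_swap[OF alternating3_wedge3])+

lemma linear_ad3: "linear (ad3 br x)"
  unfolding ad3_def by (rule linear_lift3)

context lie_algebra
begin

lemmas br_simps = bilinear_ladd[OF br_bilinear] bilinear_radd[OF br_bilinear]
  bilinear_lmul[OF br_bilinear] bilinear_rmul[OF br_bilinear]

lemma ad3_wedge3:
  "ad3 br x (wedge3 a b c) = wedge3 (br x a) b c + wedge3 a (br x b) c + wedge3 a b (br x c)"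
  unfolding ad3_def
proof (rule lift3_wedge3)
  define h where
    "h = (\<lambda>a b c. wedge3 (br x a) b c + wedge3 a (br x b) c + wedge3 a b (br x c))"
  have lin: "linear (\<lambda>a. h a b c)" "linear (\<lambda>b. h a b c)" "linear (\<lambda>c. h a b c)" for a b c
    by (simp_all add: h_def linear_iff wedge3_simps br_simps scaleR_add_right)
  have "wedge3 (br x a) a b = - wedge3 a (br x a) b" "wedge3 b (br x a) a = - wedge3 b a (br x a)"
    "wedge3 (br x a) b a = - wedge3 a b (br x a)" for a b
    by (rule wedge3_swap, rule wedge3_swap)
      (metis wedge3_swap add.inverse_inverse)
  then have "h a a b = 0" "h a b a = 0" "h b a a = 0" for a b
    by (simp_all add: h_def wedge3_simps)
  with lin have "alternating3 h" by (simp add: alternating3_def)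
  then show "alternating3
      (\<lambda>a b c. wedge3 (br x a) b c + wedge3 a (br x b) c + wedge3 a b (br x c))"
    by (simp add: h_def)
qed

lemma schouten_wedge2:
  "schouten br (wedge2 a b) (wedge2 c d) =
     wedge3 (br a c) b d - wedge3 (br a d) b c - wedge3 (br b c) a d + wedge3 (br b d) a c"
proof -
  let ?D = "schouten_decomposable br"
  have D: "?D (a + a') b c d = ?D a b c d + ?D a' b c d" "?D a (b + b') c d = ?D a b c d + ?D a b' c d"
      "?D a b (c + c') d = ?D a b c d + ?D a b c' d" "?D a b c (d + d') = ?D a b c d + ?D a b c d'"
      "?D (k *\<^sub>R a) b c d = k *\<^sub>R ?D a b c d" "?D a (k *\<^sub>R b) c d = k *\<^sub>R ?D a b c d"
      "?D a b (k *\<^sub>R c) d = k *\<^sub>R ?D a b c d" "?D a b c (k *\<^sub>R d) = k *\<^sub>R ?D a b c d"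
      "?D a a c d = 0" "?D a b c c = 0" for a a' b b' c c' d d' k
    by (simp_all add: schouten_decomposable_def wedge3_simps br_simps scaleR_add_right
        scaleR_diff_right)
  have alt: "alternating2 (?D a b)" for a b
    by (simp add: alternating2_def bilinear_def linear_iff D)
  have lin: "lift2 (?D (a + a') b) t = lift2 (?D a b) t + lift2 (?D a' b) t"
      "lift2 (?D a (b + b')) t = lift2 (?D a b) t + lift2 (?D a b') t"
      "lift2 (?D (k *\<^sub>R a) b) t = k *\<^sub>R lift2 (?D a b) t"
      "lift2 (?D a (k *\<^sub>R b)) t = k *\<^sub>R lift2 (?D a b) t"
      "lift2 (?D a a) t = 0" for a a' b b' k t
    by (simp_all add: lift2_def D sum.distrib scaleR_add_right scaleR_sum_right mult.commute)
  have alt': "alternating2 (\<lambda>a b. lift2 (schouten_decomposable br a b) t)" for t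
    by (simp add: alternating2_def bilinear_def linear_iff lin)
  show ?thesis
    unfolding schouten_def
    by (subst lift2_wedge2[OF alt'], subst lift2_wedge2[OF alt]) (rule schouten_decomposable_def)
qed

lemma bilinear_schouten: "bilinear (schouten br)"
proof -
  note L = linear_lift2[unfolded linear_iff]
  have "schouten br r (t + t') = schouten br r t + schouten br r t'"
    "schouten br r (k *\<^sub>R t) = k *\<^sub>R schouten br r t" for r t t' k
    unfolding schouten_def lift2_def[of _ r]
    by (simp_all add: L scaleR_add_right sum.distrib scaleR_sum_right mult.commute)
  moreover have "schouten br (r + r') t = schouten br r t + schouten br r' t"
    "schouten br (k *\<^sub>R r) t = k *\<^sub>R schouten br r t" for r r' t k
    unfolding schouten_def by (simp_all add: L)
  ultimately show ?thesis by (simp add: bilinear_def linear_iff)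
qed

end


section \<open>Adapted bases\<close>

text \<open>
  \<open>BS\<close> and \<open>BZ\<close> are the parts of the basis in \<open>S\<close> and in the center; the remaining basis vectors
  are the given \<open>e l\<close>, \<open>f l\<close>.
\<close>

definition basis_of :: "'a::real_vector set \<Rightarrow> 'a set \<Rightarrow> bool" where
  "basis_of V B \<longleftrightarrow> independent B \<and> span B = V"

definition adapted_basis ::
  "nat \<Rightarrow> (nat \<Rightarrow> 'a) \<Rightarrow> (nat \<Rightarrow> 'a) \<Rightarrow> 'a set \<Rightarrow> 'a set \<Rightarrow> 'a set" where
  "adapted_basis m e f BS BZ = BS \<union> BZ \<union> e ` {1..m} \<union> f ` {1..m}"

definition weights_span_dual :: "'a::real_vector set \<Rightarrow> nat \<Rightarrow> (nat \<Rightarrow> 'a \<Rightarrow> real) \<Rightarrow> bool" where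
  "weights_span_dual S m lam \<longleftrightarrow>
     (\<forall>\<phi>. linear \<phi> \<longrightarrow> (\<exists>c. \<forall>s\<in>S. \<phi> s = (\<Sum>l=1..m. c l * lam l s)))"

text \<open>
  The coefficient of \<open>a \<and> b \<and> c\<close>, for pairwise distinct \<open>a, b, c\<close> in a basis \<open>B\<close>, in the expansion
  of a trivector in the induced basis: the determinant of the corresponding coordinate functionals.
\<close>

definition trivector_coeff ::
  "'a::euclidean_space set \<Rightarrow> 'a \<Rightarrow> 'a \<Rightarrow> 'a \<Rightarrow> 'a trivector \<Rightarrow> real" where
  "trivector_coeff B a b c =
     lift3 (det3 (\<lambda>x. representation B x a) (\<lambda>x. representation B x b) (\<lambda>x. representation B x c))"

lemma trivector_coeff_wedge3:
  assumes "independent B" "span B = UNIV"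
  shows "trivector_coeff B a b c (wedge3 x y z) =
    det3 (\<lambda>x. representation B x a) (\<lambda>x. representation B x b) (\<lambda>x. representation B x c) x y z"
  unfolding trivector_coeff_def
  by (rule lift3_wedge3)
    (simp add: alternating3_def linear_iff det3_def assms real_vector.representation_add
      real_vector.representation_scale algebra_simps)

text \<open>The component in \<open>\<ss> \<and> \<real>\<omega>\<^sub>l\<close> with respect to the adapted basis.\<close>

definition s_component ::
  "nat \<Rightarrow> (nat \<Rightarrow> 'a::euclidean_space) \<Rightarrow> (nat \<Rightarrow> 'a) \<Rightarrow> 'a set \<Rightarrow> 'a set \<Rightarrow> nat \<Rightarrow> 'a trivector \<Rightarrow> 'a trivector"
  where
  "s_component m e f BS BZ l t =
     (\<Sum>s\<in>BS. trivector_coeff (adapted_basis m e f BS BZ) s (e l) (f l) t *\<^sub>R wedge3 s (e l) (f l))"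

end

theory Submission
  imports Defs
begin

text \<open>
  Let \<open>u\<close> be the derived algebra and \<open>W = u\<^sup>\<bottom>\<close>, the sum of \<open>S\<close> and the center.  The operators
  \<open>ad\<^sub>s\<close> with \<open>s\<close> in \<open>S\<close> commute and are skew; they vanish on \<open>W\<close> and act on the plane \<open>P l\<close> with
  weights \<open>\<plusminus> i \<lambda>\<^sub>l\<close>.  Nondegeneracy makes every weight of a product of three homogeneous vectors from
  \<open>W\<close> and from distinct planes nonzero, unless all three factors lie in \<open>W\<close>.  Two factors from the same
  plane give a multiple of \<open>\<omega>\<^sub>l\<close>, which has weight zero, so only the third factor counts.  Hence
  the trivectors killed by \<open>S\<close> are \<open>\<And>\<^sup>3 W \<oplus> \<Oplus>\<^sub>l W \<and> \<omega>\<^sub>l\<close>.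

  Every term of a Schouten bracket contains a factor from \<open>u\<close>, so \<open>[r, r]\<close> has no part in
  \<open>\<And>\<^sup>3 W\<close>.  It remains to decide when
  \<open>t = \<Sum>\<^sub>l a\<^sub>l \<and> \<omega>\<^sub>l\<close> with \<open>a\<^sub>l = s\<^sub>l + z\<^sub>l\<close> is killed by \<open>u\<close> as well.  As \<open>ad\<close> of \<open>e\<^sub>k\<close> sends
  \<open>a\<^sub>l \<and> \<omega>\<^sub>l\<close> to \<open>- \<lambda>\<^sub>k(s\<^sub>l) f\<^sub>k \<and> \<omega>\<^sub>l\<close>, and these trivectors for \<open>l \<noteq> k\<close> are independent while the
  one for \<open>l = k\<close> is zero, invariance amounts to \<open>\<lambda>\<^sub>k(s\<^sub>l) = 0\<close> for all \<open>k \<noteq> l\<close>, that is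
  \<open>s\<^sub>l \<in> \<ss>\<^sub>l\<close>.  The two directions are \<open>invariant_trivector_form\<close> and \<open>invariant_s_kernel_omega\<close>.

  The second form of the result follows because the component along \<open>l\<close> of such a sum in an
  adapted basis is exactly \<open>s\<^sub>l \<and> \<omega>\<^sub>l\<close> (\<open>s_component_omega_sum\<close>).
\<close>

section \<open>Trivectors as alternating forms\<close>

lemma alternating3_Rep_trivector: "alternating3 (Rep_trivector t)"
  using Rep_trivector by auto

lemma trivector_lin:
  "Rep_trivector t (a + a') b c = Rep_trivector t a b c + Rep_trivector t a' b c"
  "Rep_trivector t a (b + b') c = Rep_trivector t a b c + Rep_trivector t a b' c"
  "Rep_trivector t a b (c + c') = Rep_trivector t a b c + Rep_trivector t a b c'"
  "Rep_trivector t (k *\<^sub>R a) b c = k * Rep_trivector t a b c"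
  "Rep_trivector t a (k *\<^sub>R b) c = k * Rep_trivector t a b c"
  "Rep_trivector t a b (k *\<^sub>R c) = k * Rep_trivector t a b c"
  "Rep_trivector t a a b = 0" "Rep_trivector t a b a = 0" "Rep_trivector t b a a = 0"
  "Rep_trivector t (- a) b c = - Rep_trivector t a b c"
  "Rep_trivector t a (- b) c = - Rep_trivector t a b c"
  "Rep_trivector t a b (- c) = - Rep_trivector t a b c"
  using alternating3_Rep_trivector[of t]
  by (simp_all add: alternating3_def linear_iff linear_neg[of "\<lambda>a. Rep_trivector t a b c"]
      linear_neg[of "\<lambda>b. Rep_trivector t a b c"] linear_neg[of "\<lambda>c. Rep_trivector t a b c"])

lemma trivector_linear:
  "linear (\<lambda>a. Rep_trivector t a b c)" "linear (\<lambda>b. Rep_trivector t a b c)"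
  "linear (\<lambda>c. Rep_trivector t a b c)"
  by (simp_all add: linear_iff trivector_lin)

lemmas trivector_swap = alternating3_swap[OF alternating3_Rep_trivector]

lemma linear_Rep_trivector: "linear (\<lambda>t. Rep_trivector t x y z)"
  by (simp add: linear_iff plus_trivector.rep_eq scaleR_trivector.rep_eq)

lemma trivector_zeroI:
  assumes "span G = UNIV"
    and "\<And>x y z. x \<in> G \<Longrightarrow> y \<in> G \<Longrightarrow> z \<in> G \<Longrightarrow> Rep_trivector t x y z = 0"
  shows "t = 0"
proof -
  have 1: "Rep_trivector t x y z = 0" if "y \<in> G" "z \<in> G" for x y z
    using linear_eq_0_on_span[OF trivector_linear(1), of G t y z x] that assms by auto
  have 2: "Rep_trivector t x y z = 0" if "z \<in> G" for x y z
    using linear_eq_0_on_span[OF trivector_linear(2), of G t x z y] that assms(1) 1 by auto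
  have 3: "Rep_trivector t x y z = 0" for x y z
    using linear_eq_0_on_span[OF trivector_linear(3), of G t x y z] assms(1) 2 by auto
  show ?thesis
    by (metis (no_types) "3" Rep_trivector_inject ext zero_trivector.rep_eq)
qed

text \<open>The vectors \<open>x - i x'\<close>, \<open>y - i \<epsilon> y'\<close>, \<open>z - i \<delta> z'\<close> with signs \<open>\<epsilon>\<close>, \<open>\<delta>\<close> are joint eigenvectors of the
  operators \<open>D s\<close> on the complexification, with eigenvalues \<open>i \<alpha> s\<close>, \<open>i \<epsilon> \<beta> s\<close>, \<open>i \<delta> \<gamma> s\<close>.  By
  invariance the value of the form on them is killed by the sum of the eigenvalues, so it vanishes
  if that sum is nonzero for some \<open>s\<close>.  The real parts of these values, added up over the four
  choices of signs, give four times the value at \<open>(x, y, z)\<close>.\<close>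

lemma trivector_weight_zero:
  fixes D :: "'s \<Rightarrow> 'a::euclidean_space \<Rightarrow> 'a"
  assumes inv: "\<And>s x y z. s \<in> S \<Longrightarrow>
      Rep_trivector t (D s x) y z + Rep_trivector t x (D s y) z + Rep_trivector t x y (D s z) = 0"
    and x: "\<And>s. s \<in> S \<Longrightarrow> D s x = \<alpha> s *\<^sub>R x' \<and> D s x' = - \<alpha> s *\<^sub>R x"
    and y: "\<And>s. s \<in> S \<Longrightarrow> D s y = \<beta> s *\<^sub>R y' \<and> D s y' = - \<beta> s *\<^sub>R y"
    and z: "\<And>s. s \<in> S \<Longrightarrow> D s z = \<gamma> s *\<^sub>R z' \<and> D s z' = - \<gamma> s *\<^sub>R z"
    and nz: "\<And>\<epsilon> \<delta>. \<epsilon> \<in> {-1, 1} \<Longrightarrow> \<delta> \<in> {-1, 1} \<Longrightarrow> \<exists>s\<in>S. \<alpha> s + \<epsilon> * \<beta> s + \<delta> * \<gamma> s \<noteq> (0::real)"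
  shows "Rep_trivector t x y z = 0"
proof -
  define A B C E where "A = Rep_trivector t x y z" and "B = Rep_trivector t x y' z'"
    and "C = Rep_trivector t x' y z'" and "E = Rep_trivector t x' y' z"
  \<comment> \<open>The real part of the form at \<open>(x - i x', y - i \<epsilon> y', z - i \<delta> z')\<close>.\<close>
  have X: "A - \<epsilon> * \<delta> * B - \<delta> * C - \<epsilon> * E = 0" if \<epsilon>\<delta>: "\<epsilon> \<in> {-1, 1}" "\<delta> \<in> {-1, 1}" for \<epsilon> \<delta>
  proof -
    obtain s where s: "s \<in> S" "\<alpha> s + \<epsilon> * \<beta> s + \<delta> * \<gamma> s \<noteq> 0" using nz[OF \<epsilon>\<delta>] by blast
    note ev = x[OF s(1)] y[OF s(1)] z[OF s(1)]
    have "- \<alpha> s * A + \<beta> s * E + \<gamma> s * C = 0"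
      using inv[OF s(1), of x' y z] ev by (simp add: trivector_lin A_def E_def C_def)
    moreover have "\<alpha> s * E - \<beta> s * A + \<gamma> s * B = 0"
      using inv[OF s(1), of x y' z] ev by (simp add: trivector_lin A_def E_def B_def)
    moreover have "\<alpha> s * C + \<beta> s * B - \<gamma> s * A = 0"
      using inv[OF s(1), of x y z'] ev by (simp add: trivector_lin A_def C_def B_def)
    moreover have "- \<alpha> s * B - \<beta> s * C - \<gamma> s * E = 0"
      using inv[OF s(1), of x' y' z'] ev by (simp add: trivector_lin E_def C_def B_def)
    ultimately have "(\<alpha> s + \<epsilon> * \<beta> s + \<delta> * \<gamma> s) * (A - \<epsilon> * \<delta> * B - \<delta> * C - \<epsilon> * E) = 0"
      using \<epsilon>\<delta> by (auto simp: algebra_simps)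
    then show ?thesis using s(2) by simp
  qed
  have "A = 0" using X[of 1 1] X[of 1 "-1"] X[of "-1" 1] X[of "-1" "-1"] by simp
  then show ?thesis by (simp add: A_def)
qed


section \<open>Wedge spaces and independence\<close>

lemma sum_sets_iff:
  fixes B :: "nat \<Rightarrow> 'b::comm_monoid_add set"
  shows "t \<in> (\<Sum>l=1..m. B l) \<longleftrightarrow> (\<exists>g. (\<forall>l\<in>{1..m}. g l \<in> B l) \<and> t = (\<Sum>l=1..m. g l))"
  by (subst set_sum_alt) auto

lemma wedge_space_line:
  assumes "subspace A"
  shows "wedge_space A (span {wedge2 b c}) = (\<lambda>a. wedge3 a b c) ` A"
proof -
  have lin: "linear (\<lambda>a. wedge3 a b c)" by (simp add: linear_iff wedge3_simps)
  have "wedge12 a (k *\<^sub>R wedge2 b c) = wedge3 (k *\<^sub>R a) b c" for a k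
    using linear_lift2[of "wedge3 a"] wedge12_wedge2[of a b c]
    by (simp add: wedge12_def linear_cmul wedge3_simps)
  then have "{wedge12 a w | a w. a \<in> A \<and> w \<in> span {wedge2 b c}} = (\<lambda>a. wedge3 a b c) ` A"
    using subspace_scale[OF assms] unfolding span_singleton
    by (auto simp: image_iff) (metis scaleR_one)+
  then show ?thesis
    unfolding wedge_space_def by (simp add: assms lin linear_subspace_image)
qed

text \<open>The spans meet only in zero, so the dimension of the sum is the sum of the cardinalities; a
  spanning set with at most that many elements is independent.\<close>

lemma independent_orthogonal_Un:
  fixes A B :: "'a::euclidean_space set"
  assumes A: "independent A" and B: "independent B"
    and orth: "\<And>a b. a \<in> span A \<Longrightarrow> b \<in> span B \<Longrightarrow> a \<bullet> b = 0"
  shows "independent (A \<union> B)"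
proof -
  have fin: "finite A" "finite B" using A B independent_imp_finite by auto
  have "span A \<inter> span B \<subseteq> {0}" using orth by fastforce
  then have "dim (span A \<inter> span B) = 0" by (metis dim_eq_0)
  moreover have "dim {x + y |x y. x \<in> span A \<and> y \<in> span B} + dim (span A \<inter> span B)
      = dim (span A) + dim (span B)"
    by (rule dim_sums_Int) auto
  moreover have "{x + y |x y. x \<in> span A \<and> y \<in> span B} = span (A \<union> B)"
    by (auto simp: span_Un)
  ultimately have "dim (A \<union> B) = card A + card B"
    using A B by (simp only: dim_span add_0_right dim_eq_card_independent[OF A] dim_eq_card_independent[OF B])
  then have "card (A \<union> B) \<le> dim (A \<union> B)" by (simp add: card_Un_le)
  then show ?thesis
    using card_le_dim_spanning[of "A \<union> B" "span (A \<union> B)"] fin by (simp add: span_superset)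
qed

section \<open>Milnor decompositions\<close>

context milnor_decomposition
begin

lemma br_antisym: "br x y = - br y x"
  using alternating2_swap[of br] br_bilinear br_self by (metis alternating2_def)

lemma br_central: "z \<in> center br \<Longrightarrow> br z x = 0" "z \<in> center br \<Longrightarrow> br x z = 0"
  using br_antisym[of x z] by (simp_all add: center_def)

lemma subspace_center: "subspace (center br)"
  by (simp add: subspace_def center_def br_simps bilinear_lzero[OF br_bilinear])

lemma subspace_derived: "subspace (derived br)"
  by (simp add: derived_def)

lemma br_in_derived: "br x y \<in> derived br"
  unfolding derived_def by (rule span_base) auto

lemma J_f: "l \<in> {1..m} \<Longrightarrow> J l (f l) = - e l"
  using J_complex[OF _ e_in] J_e by fastforce

lemma P_in_derived: "l \<in> {1..m} \<Longrightarrow> v \<in> P l \<Longrightarrow> v \<in> derived br"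
proof -
  assume l: "l \<in> {1..m}" and v: "v \<in> P l"
  have "v = (\<Sum>k=1..m. if k = l then v else 0)" using l by simp
  moreover have "\<forall>k\<in>{1..m}. (if k = l then v else 0) \<in> P k"
    using v by (simp add: P_subspace subspace_0)
  ultimately show ?thesis unfolding sum_P[symmetric] sum_sets_iff
    by (intro exI[of _ "\<lambda>k. if k = l then v else 0"] conjI)
qed

lemma e_in_derived: "l \<in> {1..m} \<Longrightarrow> e l \<in> derived br"
  and f_in_derived: "l \<in> {1..m} \<Longrightarrow> f l \<in> derived br"
  using P_in_derived e_in f_in by blast+

lemma inner_e_f:
  assumes "k \<in> {1..m}" "l \<in> {1..m}"
  shows "e k \<bullet> e l = (if k = l then 1 else 0)" "f k \<bullet> f l = (if k = l then 1 else 0)"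
    "e k \<bullet> f l = 0" "f k \<bullet> e l = 0"
  using P_orth[OF assms] P_orth[OF assms(2,1)] e_in[OF assms(1)] e_in[OF assms(2)] f_in[OF assms(1)] f_in[OF assms(2)]
    e_unit[OF assms(1)] f_unit[OF assms(1)] e_f_orth[OF assms(1)]
  by (auto simp: inner_commute norm_eq_1)

lemma e_f_independent:
  assumes l: "l \<in> {1..m}"
  shows "independent {e l, f l}" "card {e l, f l} = 2"
proof -
  note i = inner_e_f[OF l l]
  have ne: "e l \<noteq> f l" "e l \<noteq> 0" "f l \<noteq> 0" using i by (auto simp: inner_commute)
  then show "card {e l, f l} = 2" by simp
  show "independent {e l, f l}"
    by (rule pairwise_orthogonal_independent)
      (use ne i in \<open>auto simp: pairwise_def orthogonal_def\<close>)
qed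

lemma P_eq_span:
  assumes l: "l \<in> {1..m}"
  shows "P l = span {e l, f l}"
proof
  show "P l \<subseteq> span {e l, f l}"
    using card_ge_dim_independent[of "{e l, f l}" "P l"] e_f_independent[OF l] P_dim[OF l]
      e_in[OF l] f_in[OF l] by simp
  show "span {e l, f l} \<subseteq> P l"
    using e_in[OF l] f_in[OF l] P_subspace[OF l] by (simp add: span_minimal)
qed

lemma P_expand:
  assumes "l \<in> {1..m}" "v \<in> P l"
  obtains a b where "v = a *\<^sub>R e l + b *\<^sub>R f l"
  using assms(2) unfolding P_eq_span[OF assms(1)] span_insert span_singleton
  by (auto simp: algebra_simps)

lemma decompose:
  obtains s z v where "s \<in> S" "z \<in> center br" "\<And>l. l \<in> {1..m} \<Longrightarrow> v l \<in> P l"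
    "x = s + z + (\<Sum>l=1..m. v l)"
proof -
  have "x \<in> S + center br + derived br" using sum_S_center_derived by simp
  then obtain s z u where "s \<in> S" "z \<in> center br" "u \<in> derived br" "x = s + z + u"
    by (auto elim!: set_plus_elim)
  then show thesis using that unfolding sum_P[symmetric] sum_sets_iff by blast
qed

text \<open>The sum of \<open>S\<close> and the center (\<open>W_eq\<close>), given as an orthogonal complement so that membership
  of a vector known only through its inner products can be checked.\<close>

definition W :: "'a set" where
  "W = {w. \<forall>u\<in>derived br. w \<bullet> u = 0}"

lemma W_eq: "w \<in> W \<longleftrightarrow> (\<exists>s\<in>S. \<exists>z\<in>center br. w = s + z)"
proof
  assume w: "w \<in> W"
  have "w \<in> S + center br + derived br" using sum_S_center_derived by simp
  then obtain s z u where d: "s \<in> S" "z \<in> center br" "u \<in> derived br" "w = s + z + u"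
    by (auto elim!: set_plus_elim)
  then have "u \<bullet> u = 0"
    using w by (auto simp: W_def inner_add_left orth_S_derived orth_center_derived)
  then show "\<exists>s\<in>S. \<exists>z\<in>center br. w = s + z" using d by auto
qed (auto simp: W_def inner_add_left orth_S_derived orth_center_derived)

lemma br_S_W: "s \<in> S \<Longrightarrow> w \<in> W \<Longrightarrow> br s w = 0"
  by (auto simp: W_eq br_simps S_abelian br_central)

lemma ad_S_skew:
  assumes s: "s \<in> S"
  shows "br s x \<bullet> y = - (x \<bullet> br s y)"
proof -
  have "\<exists>w u. w \<in> W \<and> u \<in> derived br \<and> x = w + u" for x
  proof -
    have "x \<in> S + center br + derived br" using sum_S_center_derived by simp
    then show ?thesis by (auto elim!: set_plus_elim simp: W_eq)
  qed
  then obtain w u w' u' where d: "w \<in> W" "u \<in> derived br" "x = w + u"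
    "w' \<in> W" "u' \<in> derived br" "y = w' + u'" by meson
  have "br s u \<bullet> w' = 0" "w \<bullet> br s u' = 0"
    using d br_in_derived by (auto simp: W_def inner_commute)
  then show ?thesis using d ad_skew[OF s, of u u'] br_S_W[OF s]
    by (simp add: br_simps inner_simps)
qed

text \<open>In the model of trivectors as forms on the dual, \<open>ad\<^sub>s\<close> acts through its transpose, which
  skew-symmetry identifies with \<open>- ad\<^sub>s\<close>.\<close>

lemma ad3_S_Rep:
  assumes s: "s \<in> S"
  shows "Rep_trivector (ad3 br s t) x y z =
    - (Rep_trivector t (br s x) y z + Rep_trivector t x (br s y) z + Rep_trivector t x y (br s z))"
proof -
  have "(\<lambda>t. Rep_trivector (ad3 br s t) x y z) = (\<lambda>t.
    - (Rep_trivector t (br s x) y z + Rep_trivector t x (br s y) z + Rep_trivector t x y (br s z)))"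
  proof (rule linear_eq_on_wedge3)
    show "linear (\<lambda>t. Rep_trivector (ad3 br s t) x y z)"
      using linear_compose[OF linear_ad3 linear_Rep_trivector] by (simp add: o_def)
    show "linear (\<lambda>t. - (Rep_trivector t (br s x) y z + Rep_trivector t x (br s y) z
        + Rep_trivector t x y (br s z)))"
      by (simp add: linear_iff plus_trivector.rep_eq scaleR_trivector.rep_eq algebra_simps)
    show "Rep_trivector (ad3 br s (wedge3 a b c)) x y z =
      - (Rep_trivector (wedge3 a b c) (br s x) y z + Rep_trivector (wedge3 a b c) x (br s y) z
        + Rep_trivector (wedge3 a b c) x y (br s z))" for a b c
      by (simp add: ad3_wedge3 plus_trivector.rep_eq wedge3.rep_eq det3_def ad_S_skew[OF s]
          algebra_simps)
  qed
  then show ?thesis by metis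
qed

lemma ad_S_invariant_Rep:
  assumes "ad3 br s t = 0" and "s \<in> S"
  shows "Rep_trivector t (br s x) y z + Rep_trivector t x (br s y) z
    + Rep_trivector t x y (br s z) = 0"
  using ad3_S_Rep[OF assms(2), of t x y z] assms(1) by (simp add: zero_trivector.rep_eq)

lemma br_e_f:
  assumes "l \<in> {1..m}" "s \<in> S"
  shows "br s (e l) = lam l s *\<^sub>R f l" "br s (f l) = - lam l s *\<^sub>R e l"
  using br_weight[OF assms] e_in f_in J_e J_f assms by auto

section \<open>Trivectors invariant under the abelian part\<close>

text \<open>Since \<open>\<omega>\<^sub>l\<close> has weight zero, \<open>ad\<^sub>s\<close> acts on \<open>P k \<and> \<omega>\<^sub>l\<close> through \<open>P k\<close> alone, where it is
  invertible for a suitable \<open>s\<close>.\<close>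

lemma trivector_omega_P:
  assumes inv: "\<And>s. s \<in> S \<Longrightarrow> ad3 br s t = 0" and l: "l \<in> {1..m}" and k: "k \<in> {1..m}"
    and v: "v \<in> P k"
  shows "Rep_trivector t v (e l) (f l) = 0"
proof -
  obtain s where s: "s \<in> S" "lam k s \<noteq> 0" using lam_nonzero[OF k] by blast
  have Jv: "- J k v \<in> P k" using J_into[OF k v] P_subspace[OF k] by (simp add: subspace_neg)
  have "J k (- J k v) = v" using J_complex[OF k v] J_linear[OF k] by (simp add: linear_neg)
  then have "br s (- J k v) = lam k s *\<^sub>R v" using br_weight[OF k s(1) Jv] by simp
  then show ?thesis
    using ad_S_invariant_Rep[OF inv[OF s(1)] s(1), of "- J k v" "e l" "f l"] br_e_f[OF l s(1)] s(2)
    by (simp add: trivector_lin)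
qed

lemma span_homogeneous: "span (W \<union> (\<Union>l\<in>{1..m}. P l)) = UNIV"
proof -
  have "x \<in> span (W \<union> (\<Union>l\<in>{1..m}. P l))" for x
  proof -
    obtain s z v where d: "s \<in> S" "z \<in> center br" "\<And>l. l \<in> {1..m} \<Longrightarrow> v l \<in> P l"
      "x = s + z + (\<Sum>l=1..m. v l)" using decompose[of x] by blast
    have "s + z \<in> W" using d by (auto simp: W_eq)
    then show ?thesis unfolding d(4)
      by (intro span_add[OF span_base span_sum[OF span_base]]) (use d(3) in blast)+
  qed
  then show ?thesis by auto
qed

text \<open>Because \<open>\<And>\<^sup>2 (P l)\<close> is the line through \<open>\<omega>\<^sub>l\<close>, two arguments in \<open>P l\<close> may be replaced by
  \<open>e l\<close> and \<open>f l\<close>.\<close>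

lemma trivector_zero_from_plane:
  assumes l: "l \<in> {1..m}" and x: "x \<in> P l" and y: "y \<in> P l"
    and om: "\<And>v. Rep_trivector t v (e l) (f l) = 0"
  shows "Rep_trivector t v x y = 0" "Rep_trivector t x v y = 0" "Rep_trivector t x y v = 0"
proof -
  obtain a b where "x = a *\<^sub>R e l + b *\<^sub>R f l" using P_expand[OF l x] .
  moreover obtain c d where "y = c *\<^sub>R e l + d *\<^sub>R f l" using P_expand[OF l y] .
  ultimately show *: "Rep_trivector t v x y = 0" for v
    using om[of v] trivector_swap(2)[of t v "f l" "e l"] by (simp add: trivector_lin)
  show "Rep_trivector t x v y = 0" using *[of v] trivector_swap(1)[of t x v y] by simp
  then show "Rep_trivector t x y v = 0" using trivector_swap(2)[of t x y v] by simp
qed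

text \<open>Label \<open>0\<close> stands for \<open>W\<close>, of weight zero.  Repeated nonzero labels must be excluded: a relation
  \<open>\<lambda>\<^sub>k = 2 \<lambda>\<^sub>i\<close> is compatible with nondegeneracy, and it would make \<open>\<lambda>\<^sub>i + \<lambda>\<^sub>i - \<lambda>\<^sub>k\<close> vanish.\<close>

lemma weights_nonresonant:
  assumes nd: "nondegenerate S m lam" and ijk: "i \<le> m" "j \<le> m" "k \<le> m"
    and dist: "i = j \<Longrightarrow> i = 0" "i = k \<Longrightarrow> i = 0" "j = k \<Longrightarrow> j = 0"
    and nz: "\<not> (i = 0 \<and> j = 0 \<and> k = 0)"
    and \<epsilon>\<delta>: "\<epsilon> \<in> {-1, 1}" "\<delta> \<in> {-1, 1}"
  defines "mu \<equiv> \<lambda>l s. if l = 0 then 0 else lam l s"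
  shows "\<exists>s\<in>S. mu i s + \<epsilon> * mu j s + \<delta> * mu k s \<noteq> 0"
proof (rule ccontr)
  assume "\<not> ?thesis"
  then have Z: "\<And>s. s \<in> S \<Longrightarrow> mu i s + \<epsilon> * mu j s + \<delta> * mu k s = 0" by blast
  have single: False if "p \<in> {1..m}" "\<And>s. s \<in> S \<Longrightarrow> lam p s = 0" for p
    using lam_nonzero[OF that(1)] that(2) by blast
  have double: False if "p \<in> {1..m}" "q \<in> {1..m}" "p \<noteq> q" "c \<in> {-1, 1}"
    "\<And>s. s \<in> S \<Longrightarrow> lam p s = c * lam q s" for p q and c :: real
  proof -
    from that(4,5) have "(\<forall>s\<in>S. lam p s = lam q s) \<or> (\<forall>s\<in>S. lam p s = - lam q s)" by auto
    then show False using nd that(1-3) unfolding nondegenerate_def by blast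
  qed
  have triple: False if "i \<noteq> 0" "j \<noteq> 0" "k \<noteq> 0"
  proof -
    have "\<forall>s\<in>S. lam k s = (- \<delta>) * lam i s + (- \<delta> * \<epsilon>) * lam j s"
      using Z that \<epsilon>\<delta> by (fastforce simp: mu_def)
    moreover have "- \<delta> \<in> {-1, 0, 1}" "- \<delta> * \<epsilon> \<in> {-1, 0, 1}" using \<epsilon>\<delta> by auto
    ultimately have "\<exists>a\<in>{-1, 0, 1}. \<exists>b\<in>{-1, 0, 1}. \<forall>s\<in>S. lam k s = a * lam i s + b * lam j s"
      by blast
    moreover have "i \<in> {1..m}" "j \<in> {1..m}" "k \<in> {1..m}" "i \<noteq> j" "i \<noteq> k" "j \<noteq> k"
      using that ijk dist by auto
    ultimately show False using nd unfolding nondegenerate_def by blast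
  qed
  have range: "p \<in> {1..m}" if "p \<noteq> 0" "p \<le> m" for p using that by auto
  consider "i \<noteq> 0" "j \<noteq> 0" "k \<noteq> 0" | "i = 0" "j \<noteq> 0" "k \<noteq> 0" | "i \<noteq> 0" "j = 0" "k \<noteq> 0"
    | "i \<noteq> 0" "j \<noteq> 0" "k = 0" | "i \<noteq> 0" "j = 0" "k = 0" | "i = 0" "j \<noteq> 0" "k = 0"
    | "i = 0" "j = 0" "k \<noteq> 0" using nz by linarith
  then show False
  proof cases
    case 1 then show ?thesis by (rule triple)
  next
    case 2
    then show ?thesis using double[of j k "- \<epsilon> * \<delta>"] range ijk dist Z \<epsilon>\<delta>
      by (fastforce simp: mu_def)
  next
    case 3
    then show ?thesis using double[of i k "- \<delta>"] range ijk dist Z \<epsilon>\<delta>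
      by (fastforce simp: mu_def)
  next
    case 4
    then show ?thesis using double[of i j "- \<epsilon>"] range ijk dist Z \<epsilon>\<delta>
      by (fastforce simp: mu_def)
  next
    case 5
    then show ?thesis using single[of i] range ijk Z by (auto simp: mu_def)
  next
    case 6
    then show ?thesis using single[of j] range ijk Z \<epsilon>\<delta> by (auto simp: mu_def)
  next
    case 7
    then show ?thesis using single[of k] range ijk Z \<epsilon>\<delta> by (auto simp: mu_def)
  qed
qed

text \<open>An \<open>S\<close>-invariant trivector is determined by its parts in \<open>\<And>\<^sup>3 W\<close> and along the \<open>\<omega>\<^sub>l\<close>.  Arguments
  from a common plane are covered by the hypothesis on \<open>\<omega>\<^sub>l\<close>, three arguments from \<open>W\<close> by the
  hypothesis on \<open>W\<close>, and in all other cases the weights do not cancel.\<close>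

lemma ad_S_invariant_trivector_zero:
  assumes nd: "nondegenerate S m lam"
    and inv: "\<And>s. s \<in> S \<Longrightarrow> ad3 br s t = 0"
    and WWW: "\<And>x y z. x \<in> W \<Longrightarrow> y \<in> W \<Longrightarrow> z \<in> W \<Longrightarrow> Rep_trivector t x y z = 0"
    and om: "\<And>l v. l \<in> {1..m} \<Longrightarrow> Rep_trivector t v (e l) (f l) = 0"
  shows "t = 0"
proof (rule trivector_zeroI[OF span_homogeneous])
  define V where "V l = (if l = 0 then W else P l)" for l :: nat
  define mu where "mu l s = (if l = 0 then 0 else lam l s)" for l s
  have lab: "\<exists>l\<le>m. x \<in> V l" if "x \<in> W \<union> (\<Union>l\<in>{1..m}. P l)" for x
    using that
  proof
    assume "x \<in> W" then show ?thesis by (intro exI[of _ 0]) (simp add: V_def)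
  next
    assume "x \<in> (\<Union>l\<in>{1..m}. P l)"
    then show ?thesis unfolding V_def by (metis UN_E atLeastAtMost_iff not_one_le_zero)
  qed
  have wt: "\<exists>x'. \<forall>s\<in>S. br s x = mu l s *\<^sub>R x' \<and> br s x' = - mu l s *\<^sub>R x"
    if l: "l \<le> m" and x: "x \<in> V l" for l x
  proof (cases "l = 0")
    case True
    then show ?thesis
      using x by (intro exI[of _ 0]) (simp add: V_def mu_def br_S_W bilinear_rzero[OF br_bilinear])
  next
    case False
    then have l': "l \<in> {1..m}" "x \<in> P l" using l x by (auto simp: V_def)
    show ?thesis
      using br_weight[OF l'(1) _ l'(2)] br_weight[OF l'(1) _ J_into[OF l']] J_complex[OF l'] False
      by (intro exI[of _ "J l x"]) (simp add: mu_def)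
  qed
  fix x y z
  assume "x \<in> W \<union> (\<Union>l\<in>{1..m}. P l)" "y \<in> W \<union> (\<Union>l\<in>{1..m}. P l)" "z \<in> W \<union> (\<Union>l\<in>{1..m}. P l)"
  then obtain i j k where ijk: "i \<le> m" "j \<le> m" "k \<le> m" "x \<in> V i" "y \<in> V j" "z \<in> V k"
    using lab by meson
  show "Rep_trivector t x y z = 0"
  proof (cases "(i = j \<and> i \<noteq> 0) \<or> (i = k \<and> i \<noteq> 0) \<or> (j = k \<and> j \<noteq> 0)")
    case True
    then show ?thesis
    proof (elim disjE conjE)
      assume "i = j" "i \<noteq> 0"
      then show ?thesis using ijk trivector_zero_from_plane(3)[of i x y t z] om by (simp add: V_def)
    next
      assume "i = k" "i \<noteq> 0"
      then show ?thesis using ijk trivector_zero_from_plane(2)[of i x z t y] om by (simp add: V_def)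
    next
      assume "j = k" "j \<noteq> 0"
      then show ?thesis using ijk trivector_zero_from_plane(1)[of j y z t x] om by (simp add: V_def)
    qed
  next
    case dist: False
    show ?thesis
    proof (cases "i = 0 \<and> j = 0 \<and> k = 0")
      case True
      then show ?thesis using ijk WWW by (simp add: V_def)
    next
      case False
      obtain x' y' z' where
        "\<forall>s\<in>S. br s x = mu i s *\<^sub>R x' \<and> br s x' = - mu i s *\<^sub>R x"
        "\<forall>s\<in>S. br s y = mu j s *\<^sub>R y' \<and> br s y' = - mu j s *\<^sub>R y"
        "\<forall>s\<in>S. br s z = mu k s *\<^sub>R z' \<and> br s z' = - mu k s *\<^sub>R z"
        using wt ijk by meson
      note pq = this
      have nr: "\<exists>s\<in>S. mu i s + \<epsilon> * mu j s + \<delta> * mu k s \<noteq> 0"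
        if "\<epsilon> \<in> {-1, 1}" "\<delta> \<in> {-1, 1}" for \<epsilon> \<delta>
        unfolding mu_def
        by (rule weights_nonresonant[OF nd ijk(1-3)]) (use dist False that in auto)
      show ?thesis
        by (rule trivector_weight_zero[where S=S and D=br and t=t and \<alpha>="mu i" and \<beta>="mu j"
              and \<gamma>="mu k"]) (use ad_S_invariant_Rep[OF inv] pq nr in auto)
    qed
  qed
qed

section \<open>Invariant trivectors\<close>

text \<open>Neither \<open>S\<close> nor the center nor \<open>u\<close> moves \<open>\<omega>\<^sub>l\<close>, and the only brackets with \<open>s + z\<close> that survive
  are those of \<open>s\<close> with the components in the planes.\<close>

lemma ad3_W_omega:
  assumes l: "l \<in> {1..m}" and s: "s \<in> S" and z: "z \<in> center br"
    and x: "s' \<in> S" "z' \<in> center br" "\<And>k. k \<in> {1..m} \<Longrightarrow> v k \<in> P k"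
  shows "ad3 br (s' + z' + (\<Sum>k=1..m. v k)) (wedge3 (s + z) (e l) (f l)) =
    - (\<Sum>k=1..m. lam k s *\<^sub>R wedge3 (J k (v k)) (e l) (f l))"
proof -
  let ?u = "\<Sum>k=1..m. v k"
  have u: "?u \<in> derived br"
    by (rule subspace_sum[OF subspace_derived]) (use x P_in_derived in blast)
  have lin: "linear (br s)" "linear (\<lambda>a. wedge3 a (e l) (f l))"
    using br_bilinear by (auto simp: bilinear_def linear_iff wedge3_simps)
  have "br ?u s = - (\<Sum>k=1..m. lam k s *\<^sub>R J k (v k))"
  proof -
    have "br ?u s = - br s ?u" by (rule br_antisym)
    also have "br s ?u = (\<Sum>k=1..m. br s (v k))" by (rule linear_sum[OF lin(1)])
    also have "\<dots> = (\<Sum>k=1..m. lam k s *\<^sub>R J k (v k))"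
      by (intro sum.cong refl br_weight) (use s x in auto)
    finally show ?thesis .
  qed
  then have 1: "br (s' + z' + ?u) (s + z) = - (\<Sum>k=1..m. lam k s *\<^sub>R J k (v k))"
    using S_abelian[OF x(1) s] br_central z x(2) by (simp add: br_simps)
  have 2: "br (s' + z' + ?u) (e l) = lam l s' *\<^sub>R f l"
    "br (s' + z' + ?u) (f l) = - lam l s' *\<^sub>R e l"
    using derived_abelian[OF u] e_in_derived[OF l] f_in_derived[OF l] br_central(1)[OF x(2)]
      br_e_f[OF l x(1)] by (simp_all add: br_simps)
  show ?thesis
    unfolding ad3_wedge3 1 2 linear_neg[OF lin(2)] linear_sum[OF lin(2)]
    by (simp only: wedge3_simps) simp
qed

lemma ad3_S_W_omega:
  assumes l: "l \<in> {1..m}" and a: "a \<in> W" and s': "s' \<in> S"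
  shows "ad3 br s' (wedge3 a (e l) (f l)) = 0"
proof -
  obtain s z where "s \<in> S" "z \<in> center br" "a = s + z" using a by (auto simp: W_eq)
  then show ?thesis
    using ad3_W_omega[OF l, of s z s' 0 "\<lambda>_. 0"] s' subspace_0[OF P_subspace] J_linear
      subspace_0[OF subspace_center]
    by (simp add: linear_0 wedge3_simps(4)[of 0 0, simplified])
qed

text \<open>For \<open>k \<noteq> l\<close> the weight \<open>\<lambda>\<^sub>k\<close> kills \<open>s\<close>; for \<open>k = l\<close> the term is a product of three vectors in a
  plane.\<close>

lemma invariant_s_kernel_omega:
  assumes l: "l \<in> {1..m}" and s: "s \<in> s_kernel S m lam l" and z: "z \<in> center br"
  shows "wedge3 (s + z) (e l) (f l) \<in> invariant_trivectors br"
proof -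
  have sS: "s \<in> S" and ker: "\<And>k. k \<in> {1..m} \<Longrightarrow> k \<noteq> l \<Longrightarrow> lam k s = 0"
    using s by (auto simp: s_kernel_def)
  have "ad3 br x (wedge3 (s + z) (e l) (f l)) = 0" for x
  proof -
    obtain s' z' v where d: "s' \<in> S" "z' \<in> center br" "\<And>l. l \<in> {1..m} \<Longrightarrow> v l \<in> P l"
      "x = s' + z' + (\<Sum>l=1..m. v l)" using decompose[of x] by blast
    have "lam k s *\<^sub>R wedge3 (J k (v k)) (e l) (f l) = 0" if k: "k \<in> {1..m}" for k
    proof (cases "k = l")
      case True
      obtain a b where "J l (v l) = a *\<^sub>R e l + b *\<^sub>R f l"
        using P_expand[OF l J_into[OF l d(3)[OF l]]] .
      then show ?thesis using True by (simp add: wedge3_simps)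
    qed (simp add: ker[OF k])
    then have "(\<Sum>k=1..m. lam k s *\<^sub>R wedge3 (J k (v k)) (e l) (f l)) = 0"
      by (intro sum.neutral ballI)
    moreover have "ad3 br x (wedge3 (s + z) (e l) (f l)) =
        - (\<Sum>k=1..m. lam k s *\<^sub>R wedge3 (J k (v k)) (e l) (f l))"
      unfolding d(4) by (rule ad3_W_omega[OF l sS z d(1,2)]) (rule d(3))
    ultimately show ?thesis by (simp only: minus_zero)
  qed
  then show ?thesis by (simp add: invariant_trivectors_def)
qed

lemma Rep_sum_omega:
  assumes a: "\<And>k. k \<in> {1..m} \<Longrightarrow> a k \<in> W" and l: "l \<in> {1..m}"
  shows "Rep_trivector (\<Sum>k=1..m. wedge3 (a k) (e k) (f k)) v (e l) (f l) = a l \<bullet> v"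
proof -
  have "Rep_trivector (wedge3 (a k) (e k) (f k)) v (e l) (f l) = (if k = l then a l \<bullet> v else 0)"
    if k: "k \<in> {1..m}" for k
  proof -
    have "a k \<bullet> e l = 0" "a k \<bullet> f l = 0"
      using a[OF k] e_in_derived[OF l] f_in_derived[OF l] by (auto simp: W_def)
    then show ?thesis by (simp add: wedge3.rep_eq det3_def inner_e_f[OF k l])
  qed
  then have "Rep_trivector (\<Sum>k=1..m. wedge3 (a k) (e k) (f k)) v (e l) (f l)
      = (\<Sum>k=1..m. if k = l then a l \<bullet> v else 0)"
    unfolding Rep_trivector_sum by (intro sum.cong refl)
  then show ?thesis using l by simp
qed

text \<open>The coefficient \<open>a l\<close> of \<open>\<omega>\<^sub>l\<close> is the Riesz representative of \<open>x \<mapsto> t(x, e l, f l)\<close>.  That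
  functional vanishes on \<open>u\<close> by \<open>trivector_omega_P\<close>, so \<open>a l\<close> lies in \<open>W\<close>.\<close>

lemma invariant_trivector_form:
  assumes nd: "nondegenerate S m lam" and inv: "t \<in> invariant_trivectors br"
    and WWW: "\<And>x y z. x \<in> W \<Longrightarrow> y \<in> W \<Longrightarrow> z \<in> W \<Longrightarrow> Rep_trivector t x y z = 0"
  obtains s z where "\<And>l. l \<in> {1..m} \<Longrightarrow> s l \<in> s_kernel S m lam l"
    "\<And>l. l \<in> {1..m} \<Longrightarrow> z l \<in> center br"
    "t = (\<Sum>l=1..m. wedge3 (s l + z l) (e l) (f l))"
proof -
  have inv': "ad3 br x t = 0" for x using inv by (simp add: invariant_trivectors_def)
  define a where "a l = (\<Sum>b\<in>Basis. Rep_trivector t b (e l) (f l) *\<^sub>R b)" for l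
  have a_inner: "a l \<bullet> x = Rep_trivector t x (e l) (f l)" for l x
    using linear_expand[OF trivector_linear(1)[of t "e l" "f l"], of x]
    by (simp add: a_def inner_sum_left inner_commute[of x] mult.commute)
  have aW: "a l \<in> W" if l: "l \<in> {1..m}" for l
  proof -
    have "a l \<bullet> u = 0" if u: "u \<in> derived br" for u
    proof -
      obtain v where "\<forall>k\<in>{1..m}. v k \<in> P k" "u = (\<Sum>k=1..m. v k)"
        using u unfolding sum_P[symmetric] sum_sets_iff by blast
      then show ?thesis
        using trivector_omega_P[OF inv' l] by (simp add: inner_sum_right a_inner)
    qed
    then show ?thesis by (simp add: W_def)
  qed
  define t' where "t' = (\<Sum>l=1..m. wedge3 (a l) (e l) (f l))"
  have "t - t' = 0"
  proof (rule ad_S_invariant_trivector_zero[OF nd])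
    show "ad3 br s (t - t') = 0" if "s \<in> S" for s
      using ad3_S_W_omega[OF _ aW that]
      by (simp add: t'_def linear_diff[OF linear_ad3] linear_sum[OF linear_ad3] inv')
    show "Rep_trivector (t - t') x y z = 0" if "x \<in> W" "y \<in> W" "z \<in> W" for x y z
    proof -
      have "Rep_trivector (wedge3 (a l) (e l) (f l)) x y z = 0" if l: "l \<in> {1..m}" for l
      proof -
        have "e l \<bullet> x = 0" "e l \<bullet> y = 0" "e l \<bullet> z = 0"
          using \<open>x \<in> W\<close> \<open>y \<in> W\<close> \<open>z \<in> W\<close> e_in_derived[OF l] by (auto simp: W_def inner_commute)
        then show ?thesis by (simp add: wedge3.rep_eq det3_def)
      qed
      then show ?thesis
        using WWW[OF that] by (simp add: minus_trivector.rep_eq t'_def Rep_trivector_sum)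
    qed
    show "Rep_trivector (t - t') v (e l) (f l) = 0" if l: "l \<in> {1..m}" for l v
      unfolding minus_trivector.rep_eq t'_def using Rep_sum_omega[OF aW l] a_inner by simp
  qed
  then have t: "t = (\<Sum>l=1..m. wedge3 (a l) (e l) (f l))" by (simp add: t'_def)
  have "\<forall>l\<in>{1..m}. \<exists>s z. s \<in> S \<and> z \<in> center br \<and> a l = s + z" using aW unfolding W_eq by blast
  then obtain s z where sz: "\<And>l. l \<in> {1..m} \<Longrightarrow> s l \<in> S \<and> z l \<in> center br \<and> a l = s l + z l"
    by metis
  \<comment> \<open>The coefficient of \<open>f k \<and> \<omega>\<^sub>l\<close> in \<open>ad3 br (e k) t\<close> is \<open>- lam k (s l)\<close>.\<close>
  have ker: "lam k (s l) = 0" if k: "k \<in> {1..m}" and l: "l \<in> {1..m}" and kl: "k \<noteq> l" for k l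
  proof -
    have ad_e: "ad3 br (e k) (wedge3 (a i) (e i) (f i)) = - lam k (s i) *\<^sub>R wedge3 (f k) (e i) (f i)"
      if i: "i \<in> {1..m}" for i
    proof -
      have "br (e k) (e i) = 0" "br (e k) (f i) = 0"
        using derived_abelian e_in_derived f_in_derived k i by blast+
      moreover have "br (e k) (a i) = - lam k (s i) *\<^sub>R f k"
        using sz[OF i] br_e_f(1)[OF k, of "s i"] br_antisym[of "e k" "s i"] br_central
        by (simp add: br_simps)
      ultimately show ?thesis
        by (simp only: ad3_wedge3 wedge3_simps) (simp add: wedge3_simps(4)[of 0 0, simplified]
            wedge3_simps(5)[of _ 0 0, simplified] wedge3_simps(6)[of _ _ 0 0, simplified])
    qed
    have "0 = Rep_trivector (ad3 br (e k) t) (f k) (e l) (f l)"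
      by (simp add: inv' zero_trivector.rep_eq)
    also have "\<dots> = (\<Sum>i=1..m. - lam k (s i) * Rep_trivector (wedge3 (f k) (e i) (f i)) (f k) (e l) (f l))"
      unfolding t linear_sum[OF linear_ad3] Rep_trivector_sum
      by (intro sum.cong refl) (simp add: ad_e scaleR_trivector.rep_eq uminus_trivector.rep_eq)
    also have "\<dots> = (\<Sum>i=1..m. if i = l then - lam k (s l) else 0)"
      by (intro sum.cong refl)
        (use k l kl in \<open>simp add: wedge3.rep_eq det3_def inner_e_f\<close>)
    also have "\<dots> = - lam k (s l)" using l by simp
    finally show ?thesis by simp
  qed
  show thesis
  proof (rule that)
    show "s l \<in> s_kernel S m lam l" if "l \<in> {1..m}" for l
      using sz[OF that] ker that by (auto simp: s_kernel_def)
    show "z l \<in> center br" if "l \<in> {1..m}" for l using sz[OF that] by blast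
    show "t = (\<Sum>l=1..m. wedge3 (s l + z l) (e l) (f l))"
      unfolding t by (intro sum.cong refl) (use sz in auto)
  qed
qed

text \<open>Each term of the bracket has a factor in \<open>u\<close>, which is orthogonal to \<open>W\<close>.\<close>

lemma schouten_vanishes_on_W:
  assumes "x \<in> W" "y \<in> W" "z \<in> W"
  shows "Rep_trivector (schouten br r t) x y z = 0"
proof -
  have "Rep_trivector (wedge3 (br a b) c d) x y z = 0" for a b c d
  proof -
    have "br a b \<bullet> x = 0" "br a b \<bullet> y = 0" "br a b \<bullet> z = 0"
      using assms br_in_derived by (auto simp: W_def inner_commute)
    then show ?thesis by (simp add: wedge3.rep_eq det3_def)
  qed
  then show ?thesis
    unfolding schouten_def lift2_def schouten_decomposable_def
    by (simp add: Rep_trivector_sum scaleR_trivector.rep_eq plus_trivector.rep_eq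
        minus_trivector.rep_eq)
qed

lemma subspace_s_kernel: "subspace (s_kernel S m lam l)"
  using S_subspace lam_linear
  by (auto simp: subspace_def s_kernel_def linear_0 linear_add linear_cmul)

lemma omega_sum_iff:
  assumes A: "\<And>l. l \<in> {1..m} \<Longrightarrow> subspace (A l)"
  shows "t \<in> (\<Sum>l=1..m. wedge_space (A l) (span {omega e f l})) +
      (\<Sum>l=1..m. wedge_space (center br) (span {omega e f l})) \<longleftrightarrow>
    (\<exists>s z. (\<forall>l\<in>{1..m}. s l \<in> A l \<and> z l \<in> center br) \<and>
      t = (\<Sum>l=1..m. wedge3 (s l + z l) (e l) (f l)))" (is "?L \<longleftrightarrow> ?R")
proof
  assume ?L
  then obtain g h where gh: "\<And>l. l \<in> {1..m} \<Longrightarrow> g l \<in> wedge_space (A l) (span {omega e f l})"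
    "\<And>l. l \<in> {1..m} \<Longrightarrow> h l \<in> wedge_space (center br) (span {omega e f l})"
    "t = (\<Sum>l=1..m. g l) + (\<Sum>l=1..m. h l)"
    by (elim set_plus_elim) (auto simp only: sum_sets_iff)
  have "\<forall>l\<in>{1..m}. \<exists>s z. s \<in> A l \<and> z \<in> center br \<and> g l + h l = wedge3 (s + z) (e l) (f l)"
    using gh(1,2) wedge_space_line[OF A] wedge_space_line[OF subspace_center]
    unfolding omega_def by (auto simp: wedge3_simps image_iff) (metis)
  then obtain s z where
    "\<forall>l\<in>{1..m}. s l \<in> A l \<and> z l \<in> center br \<and> g l + h l = wedge3 (s l + z l) (e l) (f l)"
    by metis
  moreover from this have "t = (\<Sum>l=1..m. wedge3 (s l + z l) (e l) (f l))"
    unfolding gh(3) sum.distrib[symmetric] by (intro sum.cong refl) auto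
  ultimately show ?R by blast
next
  assume ?R
  then obtain s z where sz: "\<And>l. l \<in> {1..m} \<Longrightarrow> s l \<in> A l \<and> z l \<in> center br"
    "t = (\<Sum>l=1..m. wedge3 (s l + z l) (e l) (f l))" by blast
  have "t = (\<Sum>l=1..m. wedge3 (s l) (e l) (f l)) + (\<Sum>l=1..m. wedge3 (z l) (e l) (f l))"
    by (simp add: sz(2) wedge3_simps sum.distrib)
  moreover have "(\<Sum>l=1..m. wedge3 (s l) (e l) (f l))
      \<in> (\<Sum>l=1..m. wedge_space (A l) (span {omega e f l}))"
    unfolding sum_sets_iff
    by (rule exI[of _ "\<lambda>l. wedge3 (s l) (e l) (f l)"])
      (use sz(1) in \<open>auto simp: omega_def wedge_space_line[OF A]\<close>)
  moreover have "(\<Sum>l=1..m. wedge3 (z l) (e l) (f l))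
      \<in> (\<Sum>l=1..m. wedge_space (center br) (span {omega e f l}))"
    unfolding sum_sets_iff
    by (rule exI[of _ "\<lambda>l. wedge3 (z l) (e l) (f l)"])
      (use sz(1) in \<open>auto simp: omega_def wedge_space_line[OF subspace_center]\<close>)
  ultimately show ?L by (simp add: set_plus_intro)
qed

theorem schouten_square_invariant_iff:
  assumes nd: "nondegenerate S m lam"
  shows "schouten br r r \<in> invariant_trivectors br \<longleftrightarrow>
    schouten br r r \<in>
      (\<Sum>l=1..m. wedge_space (s_kernel S m lam l) (span {omega e f l})) +
      (\<Sum>l=1..m. wedge_space (center br) (span {omega e f l}))" (is "?t \<in> ?I \<longleftrightarrow> ?t \<in> ?R")
proof
  assume "?t \<in> ?I"
  then obtain s z where "\<And>l. l \<in> {1..m} \<Longrightarrow> s l \<in> s_kernel S m lam l"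
    "\<And>l. l \<in> {1..m} \<Longrightarrow> z l \<in> center br" "?t = (\<Sum>l=1..m. wedge3 (s l + z l) (e l) (f l))"
    by (rule invariant_trivector_form[OF nd]) (auto intro: schouten_vanishes_on_W)
  then show "?t \<in> ?R" unfolding omega_sum_iff[OF subspace_s_kernel] by blast
next
  assume "?t \<in> ?R"
  then obtain s z where sz: "\<forall>l\<in>{1..m}. s l \<in> s_kernel S m lam l \<and> z l \<in> center br"
    "?t = (\<Sum>l=1..m. wedge3 (s l + z l) (e l) (f l))"
    unfolding omega_sum_iff[OF subspace_s_kernel] by blast
  have "subspace ?I"
    by (auto simp: subspace_def invariant_trivectors_def linear_0[OF linear_ad3]
        linear_add[OF linear_ad3] linear_cmul[OF linear_ad3])
  then show "?t \<in> ?I"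
    unfolding sz(2) by (rule subspace_sum) (use sz(1) invariant_s_kernel_omega in blast)
qed


section \<open>Components in an adapted basis\<close>

lemma e_f_basis:
  "independent (e ` {1..m} \<union> f ` {1..m})" "span (e ` {1..m} \<union> f ` {1..m}) = derived br"
proof -
  let ?B = "e ` {1..m} \<union> f ` {1..m}"
  show "independent ?B"
  proof (rule pairwise_orthogonal_independent)
    show "pairwise orthogonal ?B"
      using inner_e_f by (auto simp: pairwise_def orthogonal_def split: if_splits)
    show "0 \<notin> ?B" using e_unit f_unit by fastforce
  qed
  show "span ?B = derived br"
  proof
    show "span ?B \<subseteq> derived br"
      by (rule span_minimal[OF _ subspace_derived]) (use e_in_derived f_in_derived in blast)
    show "derived br \<subseteq> span ?B"
    proof
      fix u assume "u \<in> derived br"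
      then obtain v where v: "\<forall>k\<in>{1..m}. v k \<in> P k" "u = (\<Sum>k=1..m. v k)"
        unfolding sum_P[symmetric] sum_sets_iff by blast
      have "v k \<in> span ?B" if "k \<in> {1..m}" for k
        using v(1) that P_eq_span[OF that] span_mono[of "{e k, f k}" ?B] by blast
      then show "u \<in> span ?B" unfolding v(2) by (rule span_sum)
    qed
  qed
qed

lemma adapted_basis_basis:
  assumes BS: "basis_of S BS" and BZ: "basis_of (center br) BZ"
  shows "independent (adapted_basis m e f BS BZ)" "span (adapted_basis m e f BS BZ) = UNIV"
proof -
  let ?U = "e ` {1..m} \<union> f ` {1..m}"
  have B: "independent BS" "span BS = S" "independent BZ" "span BZ = center br"
    using BS BZ by (auto simp: basis_of_def)
  have eq: "adapted_basis m e f BS BZ = (BS \<union> BZ) \<union> ?U" by (auto simp: adapted_basis_def)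
  have sp: "span (BS \<union> BZ) = W"
    unfolding span_Un B by (rule set_eqI, unfold W_eq mem_Collect_eq) blast
  have "independent (BS \<union> BZ)"
    by (rule independent_orthogonal_Un) (use B orth_S_center in auto)
  then show "independent (adapted_basis m e f BS BZ)"
    unfolding eq by (rule independent_orthogonal_Un[OF _ e_f_basis(1)])
      (unfold sp e_f_basis(2), simp add: W_def)
  have "x \<in> span (adapted_basis m e f BS BZ)" for x
  proof -
    have "x \<in> S + center br + derived br" using sum_S_center_derived by simp
    then show ?thesis unfolding eq span_Un[of "BS \<union> BZ"] sp e_f_basis(2)
      by (auto elim!: set_plus_elim simp: W_eq)
  qed
  then show "span (adapted_basis m e f BS BZ) = UNIV" by blast
qed

text \<open>A trivector \<open>(s k + z k) \<and> e k \<and> f k\<close> has a coefficient at \<open>\<sigma> \<and> e l \<and> f l\<close> only if \<open>k = l\<close>, and then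
  it is the coordinate of \<open>s l\<close> at \<open>\<sigma>\<close>, because central vectors have no coordinates along \<open>S\<close>.\<close>

lemma s_component_omega_sum:
  assumes BS: "basis_of S BS" and BZ: "basis_of (center br) BZ"
    and sz: "\<And>l. l \<in> {1..m} \<Longrightarrow> s l \<in> S" "\<And>l. l \<in> {1..m} \<Longrightarrow> z l \<in> center br"
    and l: "l \<in> {1..m}"
  shows "s_component m e f BS BZ l (\<Sum>k=1..m. wedge3 (s k + z k) (e k) (f k))
    = wedge3 (s l) (e l) (f l)"
proof -
  define B where "B = adapted_basis m e f BS BZ"
  note B = adapted_basis_basis[OF BS BZ, folded B_def]
  have sub: "BS \<subseteq> B" "BZ \<subseteq> B" and efB: "\<And>k. k \<in> {1..m} \<Longrightarrow> e k \<in> B \<and> f k \<in> B"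
    by (auto simp: B_def adapted_basis_def)
  have BSS: "BS \<subseteq> S" "BZ \<subseteq> center br" "independent BS" "span BS = S" "span BZ = center br"
    using BS BZ span_superset by (auto simp: basis_of_def)
  have repB: "representation B b c = (if c = b then 1 else 0)" if "b \<in> B" for b c
    using representation_basis[OF B(1) that] by simp
  have ne: "\<sigma> \<noteq> e k" "\<sigma> \<noteq> f k" if "\<sigma> \<in> BS" "k \<in> {1..m}" for \<sigma> k
    using that BSS(1) orth_S_derived[of \<sigma> "e k"] orth_S_derived[of \<sigma> "f k"]
      e_in_derived f_in_derived inner_e_f(1,2)[OF that(2) that(2)] by auto
  have efne: "e k \<noteq> f j" "e k = e j \<longleftrightarrow> k = j" "f k = f j \<longleftrightarrow> k = j"
    if "k \<in> {1..m}" "j \<in> {1..m}" for k j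
    using inner_e_f[OF that] inner_e_f[OF that(1) that(1)] by (auto split: if_splits)
  have repz: "representation B y \<sigma> = 0" if "y \<in> center br" "\<sigma> \<in> BS" for y \<sigma>
  proof -
    have "\<sigma> \<noteq> 0" using BSS(3) that(2) dependent_zero by blast
    moreover have "\<sigma> \<bullet> \<sigma> = 0" if "\<sigma> \<in> BZ"
      using that \<open>\<sigma> \<in> BS\<close> BSS orth_S_center by blast
    ultimately have "\<sigma> \<notin> BZ" by auto
    moreover have "independent BZ" "y \<in> span BZ" using BZ that by (auto simp: basis_of_def)
    ultimately show ?thesis
      using representation_extend[OF B(1) \<open>y \<in> span BZ\<close> sub(2)]
        representation_ne_zero[of BZ y \<sigma>] by metis
  qed
  have coeff: "trivector_coeff B \<sigma> (e l) (f l) (\<Sum>k=1..m. wedge3 (s k + z k) (e k) (f k))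
      = representation BS (s l) \<sigma>" if \<sigma>: "\<sigma> \<in> BS" for \<sigma>
  proof -
    have "trivector_coeff B \<sigma> (e l) (f l) (wedge3 (s k + z k) (e k) (f k))
        = (if k = l then representation B (s k) \<sigma> else 0)" if k: "k \<in> {1..m}" for k
      using efB[OF k] ne[OF \<sigma> k] efne[OF k l] efne[OF l k] repz[OF sz(2)[OF k] \<sigma>]
      by (auto simp: trivector_coeff_wedge3[OF B] det3_def repB representation_add[OF B(1)] B(2))
    then have "trivector_coeff B \<sigma> (e l) (f l) (\<Sum>k=1..m. wedge3 (s k + z k) (e k) (f k))
        = (\<Sum>k=1..m. if k = l then representation B (s k) \<sigma> else 0)"
      unfolding trivector_coeff_def linear_sum[OF linear_lift3] by (intro sum.cong refl)
    also have "\<dots> = representation B (s l) \<sigma>" using l by simp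
    also have "\<dots> = representation BS (s l) \<sigma>"
      using representation_extend[OF B(1) _ sub(1)] sz(1)[OF l] BSS(4) by simp
    finally show ?thesis .
  qed
  have lin: "linear (\<lambda>a. wedge3 a (e l) (f l))" by (simp add: linear_iff wedge3_simps)
  have "s_component m e f BS BZ l (\<Sum>k=1..m. wedge3 (s k + z k) (e k) (f k))
      = (\<Sum>\<sigma>\<in>BS. wedge3 (representation BS (s l) \<sigma> *\<^sub>R \<sigma>) (e l) (f l))"
    unfolding s_component_def B_def[symmetric]
    by (intro sum.cong refl) (simp only: coeff wedge3_simps(4))
  also have "\<dots> = wedge3 (\<Sum>\<sigma>\<in>BS. representation BS (s l) \<sigma> *\<^sub>R \<sigma>) (e l) (f l)"
    by (rule linear_sum[OF lin, symmetric])
  also have "(\<Sum>\<sigma>\<in>BS. representation BS (s l) \<sigma> *\<^sub>R \<sigma>) = s l"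
    by (rule sum_representation_eq)
      (use BSS sz(1)[OF l] independent_imp_finite in auto)
  finally show ?thesis .
qed

lemma omega_sum_components_iff:
  assumes BS: "basis_of S BS" and BZ: "basis_of (center br) BZ"
  shows "t \<in> (\<Sum>l=1..m. wedge_space (s_kernel S m lam l) (span {omega e f l})) +
      (\<Sum>l=1..m. wedge_space (center br) (span {omega e f l})) \<longleftrightarrow>
    t \<in> (\<Sum>l=1..m. wedge_space S (span {omega e f l})) +
      (\<Sum>l=1..m. wedge_space (center br) (span {omega e f l})) \<and>
    (\<forall>l\<in>{1..m}. s_component m e f BS BZ l t
       \<in> wedge_space (s_kernel S m lam l) (span {omega e f l}))" (is "?L \<longleftrightarrow> ?R")
proof
  assume ?L
  then obtain s z where sz: "\<forall>l\<in>{1..m}. s l \<in> s_kernel S m lam l \<and> z l \<in> center br"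
    "t = (\<Sum>l=1..m. wedge3 (s l + z l) (e l) (f l))"
    unfolding omega_sum_iff[OF subspace_s_kernel] by blast
  have S: "\<forall>l\<in>{1..m}. s l \<in> S \<and> z l \<in> center br" using sz(1) by (auto simp: s_kernel_def)
  have "s_component m e f BS BZ l t \<in> wedge_space (s_kernel S m lam l) (span {omega e f l})"
    if l: "l \<in> {1..m}" for l
    using s_component_omega_sum[OF BS BZ _ _ l, of s z] S sz l
    by (simp add: omega_def wedge_space_line[OF subspace_s_kernel])
  then show ?R unfolding omega_sum_iff[OF S_subspace] using S sz(2) by blast
next
  assume R: ?R
  then obtain s z where S: "\<forall>l\<in>{1..m}. s l \<in> S \<and> z l \<in> center br"
    "t = (\<Sum>l=1..m. wedge3 (s l + z l) (e l) (f l))"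
    unfolding omega_sum_iff[OF S_subspace] by blast
  have "\<exists>s'\<in>s_kernel S m lam l. wedge3 (s l) (e l) (f l) = wedge3 s' (e l) (f l)"
    if l: "l \<in> {1..m}" for l
  proof -
    have "s_component m e f BS BZ l t = wedge3 (s l) (e l) (f l)"
      unfolding S(2) by (rule s_component_omega_sum[OF BS BZ]) (use S(1) l in auto)
    then have "wedge3 (s l) (e l) (f l) \<in> (\<lambda>a. wedge3 a (e l) (f l)) ` s_kernel S m lam l"
      using R l unfolding omega_def wedge_space_line[OF subspace_s_kernel] by metis
    then show ?thesis by blast
  qed
  then obtain s' where s': "\<And>l. l \<in> {1..m} \<Longrightarrow> s' l \<in> s_kernel S m lam l \<and>
      wedge3 (s l) (e l) (f l) = wedge3 (s' l) (e l) (f l)" by metis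
  have "t = (\<Sum>l=1..m. wedge3 (s' l + z l) (e l) (f l))"
    unfolding S(2) by (intro sum.cong refl) (use s' in \<open>simp add: wedge3_simps\<close>)
  then show ?L unfolding omega_sum_iff[OF subspace_s_kernel] using S(1) s' by blast
qed

end

theorem theorem6p1:
  fixes br :: "'a::euclidean_space \<Rightarrow> 'a \<Rightarrow> 'a"
    and S :: "'a set" and m :: nat and P :: "nat \<Rightarrow> 'a set"
    and lam :: "nat \<Rightarrow> 'a \<Rightarrow> real" and J :: "nat \<Rightarrow> 'a \<Rightarrow> 'a"
    and e f :: "nat \<Rightarrow> 'a" and r :: "'a bivector"
  assumes "milnor_decomposition br S m P lam J e f"
    and "nondegenerate S m lam"
  shows
    "(schouten br r r \<in> invariant_trivectors br \<longleftrightarrow>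
        schouten br r r \<in>
          (\<Sum>l=1..m. wedge_space (s_kernel S m lam l) (span {omega e f l})) +
          (\<Sum>l=1..m. wedge_space (center br) (span {omega e f l})))
     \<and>
     (\<forall>BS BZ. basis_of S BS \<and> basis_of (center br) BZ \<and> weights_span_dual S m lam \<longrightarrow>
        (schouten br r r \<in> invariant_trivectors br \<longleftrightarrow>
          schouten br r r \<in>
            (\<Sum>l=1..m. wedge_space S (span {omega e f l})) +
            (\<Sum>l=1..m. wedge_space (center br) (span {omega e f l})) \<and>
          (\<forall>l\<in>{1..m}. s_component m e f BS BZ l (schouten br r r)
             \<in> wedge_space (s_kernel S m lam l) (span {omega e f l}))) \<and>
        (schouten br r r \<in> invariant_trivectors br \<longrightarrow>
          (\<forall>l\<in>{1..m}. s_component m e f BS BZ l (schouten br r r) \<noteq> 0 \<longrightarrow>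
             s_kernel S m lam l \<noteq> {0})))"
proof -
  interpret milnor_decomposition br S m P lam J e f by (rule assms(1))
  note main = schouten_square_invariant_iff[OF assms(2), of r]
  have zero: "wedge_space {0} (span {omega e f l}) = {0}" for l
    using wedge_space_line[of "{0}" "e l" "f l"] wedge3_simps(4)[of 0 0 "e l" "f l"]
    by (simp add: omega_def)
  show ?thesis
  proof (intro conjI allI impI ballI)
    show "schouten br r r \<in> invariant_trivectors br \<longleftrightarrow>
        schouten br r r \<in>
          (\<Sum>l=1..m. wedge_space (s_kernel S m lam l) (span {omega e f l})) +
          (\<Sum>l=1..m. wedge_space (center br) (span {omega e f l}))" by (rule main)
  next
    fix BS BZ
    assume b: "basis_of S BS \<and> basis_of (center br) BZ \<and> weights_span_dual S m lam"
    then have BS: "basis_of S BS" and BZ: "basis_of (center br) BZ" by auto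
    note comp = omega_sum_components_iff[OF BS BZ, of "schouten br r r"]
    show "schouten br r r \<in> invariant_trivectors br \<longleftrightarrow>
          schouten br r r \<in>
            (\<Sum>l=1..m. wedge_space S (span {omega e f l})) +
            (\<Sum>l=1..m. wedge_space (center br) (span {omega e f l})) \<and>
          (\<forall>l\<in>{1..m}. s_component m e f BS BZ l (schouten br r r)
             \<in> wedge_space (s_kernel S m lam l) (span {omega e f l}))"
      unfolding main by (rule comp)
    fix l
    assume "schouten br r r \<in> invariant_trivectors br" "l \<in> {1..m}"
      "s_component m e f BS BZ l (schouten br r r) \<noteq> 0"
    then show "s_kernel S m lam l \<noteq> {0}" using main comp zero by fastforce
  qed
qed

end
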